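(* For any type $A:\mathcal U$, the following are logically equivalent: (1) for every $\alpha:\mathbb N\to 2$, $\Big(\prod_{n:\mathbb N}\big\lVert(\alpha_n=1)\to A\big\rVert\Big)\to\Big\lVert\prod_{n:\mathbb N}\big((\alpha_n=1)\to A\big)\Big\rVert$; (2) for every proposition $P:\mathcal U$ with $\operatorname{isRosolini}(P)$, $\big(P\to\lVert A\rVert\big)\to\lVert P\to A\rVert$.
   Context: Type theory: Martin-Löf type theory with universe $\mathcal U$, function extensionality, proposition extensionality and propositional truncations $\lVert X\rVert$. For $\alpha:\mathbb N\to 2$ let $\langle\alpha\rangle:=\sum_{n:\mathbb N}(\alpha_n=1)$; $\mathbb N_\infty:=\sum_{\alpha:\mathbb N\to2}\operatorname{isProp}(\langle\alpha\rangle)$. A type $P$ is Rosolini, $\operatorname{isRosolini}(P)$, if $\big\lVert\sum_{u:\mathbb N_\infty}(P=\langle u\rangle)\big\rVert$. *)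

theory Defs
  imports Main
begin

text \<open>
  The statement concerns intensional Martin-Loef type theory and has no content when read in
  classical HOL, so the type theory itself is formalised, with de Bruijn indices, as an inductively
  generated derivability relation. The presentation is the usual one with contexts, typing
  and judgemental equality, and a cumulative hierarchy of Russell universes, any one of which can
  play the role of the universe of the statement; every type is an
  element of some universe.
\<close>

subsection \<open>Raw syntax\<close>

text \<open>
  Binding: the second argument of \<open>PiT\<close>, \<open>SigT\<close> and \<open>Lam\<close> binds one variable. The first argument
  of an induction operator is its motive, which binds one variable (two for \<open>J\<close>: the end point,
  index 1, and the path, index 0). The branches of \<open>SumInd\<close> bind one variable; the successor branch
  of \<open>NatInd\<close> binds two: the predecessor, index 1, and the inductive hypothesis, index 0.
\<close>

datatype tm =
    Var nat
  | Univ nat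
  | PiT tm tm | Lam tm tm | App tm tm
  | SigT tm tm | MkPair tm tm | Fst tm | Snd tm
  | EmptyT | EmptyInd tm tm
  | UnitT | Star | UnitInd tm tm tm
  | SumT tm tm | InL tm | InR tm | SumInd tm tm tm tm
  | TwoT | Two0 | Two1 | TwoInd tm tm tm tm
  | NatT | Zero | Succ tm | NatInd tm tm tm tm
  | IdT tm tm tm | Refl tm | J tm tm tm
  | Trunc tm | TrIn tm | TrEq tm tm | TrRec tm tm tm
  | FunExt tm tm tm
  | PropExt tm tm tm tm

definition scons :: "'a \<Rightarrow> (nat \<Rightarrow> 'a) \<Rightarrow> nat \<Rightarrow> 'a" (infixr "\<bullet>" 65) where
  "a \<bullet> \<sigma> = (\<lambda>n. case n of 0 \<Rightarrow> a | Suc m \<Rightarrow> \<sigma> m)"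

definition upr :: "(nat \<Rightarrow> nat) \<Rightarrow> nat \<Rightarrow> nat" where
  "upr \<rho> = 0 \<bullet> (\<lambda>n. Suc (\<rho> n))"

primrec ren :: "(nat \<Rightarrow> nat) \<Rightarrow> tm \<Rightarrow> tm" where
  "ren \<rho> (Var n) = Var (\<rho> n)"
| "ren \<rho> (Univ i) = Univ i"
| "ren \<rho> (PiT A B) = PiT (ren \<rho> A) (ren (upr \<rho>) B)"
| "ren \<rho> (Lam A b) = Lam (ren \<rho> A) (ren (upr \<rho>) b)"
| "ren \<rho> (App f a) = App (ren \<rho> f) (ren \<rho> a)"
| "ren \<rho> (SigT A B) = SigT (ren \<rho> A) (ren (upr \<rho>) B)"
| "ren \<rho> (MkPair a b) = MkPair (ren \<rho> a) (ren \<rho> b)"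
| "ren \<rho> (Fst p) = Fst (ren \<rho> p)"
| "ren \<rho> (Snd p) = Snd (ren \<rho> p)"
| "ren \<rho> EmptyT = EmptyT"
| "ren \<rho> (EmptyInd C e) = EmptyInd (ren (upr \<rho>) C) (ren \<rho> e)"
| "ren \<rho> UnitT = UnitT"
| "ren \<rho> Star = Star"
| "ren \<rho> (UnitInd C c u) = UnitInd (ren (upr \<rho>) C) (ren \<rho> c) (ren \<rho> u)"
| "ren \<rho> (SumT A B) = SumT (ren \<rho> A) (ren \<rho> B)"
| "ren \<rho> (InL a) = InL (ren \<rho> a)"
| "ren \<rho> (InR b) = InR (ren \<rho> b)"
| "ren \<rho> (SumInd C l r s) = SumInd (ren (upr \<rho>) C) (ren (upr \<rho>) l) (ren (upr \<rho>) r) (ren \<rho> s)"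
| "ren \<rho> TwoT = TwoT"
| "ren \<rho> Two0 = Two0"
| "ren \<rho> Two1 = Two1"
| "ren \<rho> (TwoInd C c d b) = TwoInd (ren (upr \<rho>) C) (ren \<rho> c) (ren \<rho> d) (ren \<rho> b)"
| "ren \<rho> NatT = NatT"
| "ren \<rho> Zero = Zero"
| "ren \<rho> (Succ n) = Succ (ren \<rho> n)"
| "ren \<rho> (NatInd C z s n) = NatInd (ren (upr \<rho>) C) (ren \<rho> z) (ren (upr (upr \<rho>)) s) (ren \<rho> n)"
| "ren \<rho> (IdT A a b) = IdT (ren \<rho> A) (ren \<rho> a) (ren \<rho> b)"
| "ren \<rho> (Refl a) = Refl (ren \<rho> a)"
| "ren \<rho> (J C d p) = J (ren (upr (upr \<rho>)) C) (ren \<rho> d) (ren \<rho> p)"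
| "ren \<rho> (Trunc A) = Trunc (ren \<rho> A)"
| "ren \<rho> (TrIn a) = TrIn (ren \<rho> a)"
| "ren \<rho> (TrEq x y) = TrEq (ren \<rho> x) (ren \<rho> y)"
| "ren \<rho> (TrRec h f x) = TrRec (ren \<rho> h) (ren \<rho> f) (ren \<rho> x)"
| "ren \<rho> (FunExt f g h) = FunExt (ren \<rho> f) (ren \<rho> g) (ren \<rho> h)"
| "ren \<rho> (PropExt p q f g) = PropExt (ren \<rho> p) (ren \<rho> q) (ren \<rho> f) (ren \<rho> g)"

abbreviation wk :: "tm \<Rightarrow> tm" where
  "wk \<equiv> ren Suc"

definition ups :: "(nat \<Rightarrow> tm) \<Rightarrow> nat \<Rightarrow> tm" where
  "ups \<sigma> = Var 0 \<bullet> (\<lambda>n. wk (\<sigma> n))"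

primrec sub :: "(nat \<Rightarrow> tm) \<Rightarrow> tm \<Rightarrow> tm" where
  "sub \<sigma> (Var n) = \<sigma> n"
| "sub \<sigma> (Univ i) = Univ i"
| "sub \<sigma> (PiT A B) = PiT (sub \<sigma> A) (sub (ups \<sigma>) B)"
| "sub \<sigma> (Lam A b) = Lam (sub \<sigma> A) (sub (ups \<sigma>) b)"
| "sub \<sigma> (App f a) = App (sub \<sigma> f) (sub \<sigma> a)"
| "sub \<sigma> (SigT A B) = SigT (sub \<sigma> A) (sub (ups \<sigma>) B)"
| "sub \<sigma> (MkPair a b) = MkPair (sub \<sigma> a) (sub \<sigma> b)"
| "sub \<sigma> (Fst p) = Fst (sub \<sigma> p)"
| "sub \<sigma> (Snd p) = Snd (sub \<sigma> p)"
| "sub \<sigma> EmptyT = EmptyT"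
| "sub \<sigma> (EmptyInd C e) = EmptyInd (sub (ups \<sigma>) C) (sub \<sigma> e)"
| "sub \<sigma> UnitT = UnitT"
| "sub \<sigma> Star = Star"
| "sub \<sigma> (UnitInd C c u) = UnitInd (sub (ups \<sigma>) C) (sub \<sigma> c) (sub \<sigma> u)"
| "sub \<sigma> (SumT A B) = SumT (sub \<sigma> A) (sub \<sigma> B)"
| "sub \<sigma> (InL a) = InL (sub \<sigma> a)"
| "sub \<sigma> (InR b) = InR (sub \<sigma> b)"
| "sub \<sigma> (SumInd C l r s) = SumInd (sub (ups \<sigma>) C) (sub (ups \<sigma>) l) (sub (ups \<sigma>) r) (sub \<sigma> s)"
| "sub \<sigma> TwoT = TwoT"
| "sub \<sigma> Two0 = Two0"
| "sub \<sigma> Two1 = Two1"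
| "sub \<sigma> (TwoInd C c d b) = TwoInd (sub (ups \<sigma>) C) (sub \<sigma> c) (sub \<sigma> d) (sub \<sigma> b)"
| "sub \<sigma> NatT = NatT"
| "sub \<sigma> Zero = Zero"
| "sub \<sigma> (Succ n) = Succ (sub \<sigma> n)"
| "sub \<sigma> (NatInd C z s n) = NatInd (sub (ups \<sigma>) C) (sub \<sigma> z) (sub (ups (ups \<sigma>)) s) (sub \<sigma> n)"
| "sub \<sigma> (IdT A a b) = IdT (sub \<sigma> A) (sub \<sigma> a) (sub \<sigma> b)"
| "sub \<sigma> (Refl a) = Refl (sub \<sigma> a)"
| "sub \<sigma> (J C d p) = J (sub (ups (ups \<sigma>)) C) (sub \<sigma> d) (sub \<sigma> p)"
| "sub \<sigma> (Trunc A) = Trunc (sub \<sigma> A)"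
| "sub \<sigma> (TrIn a) = TrIn (sub \<sigma> a)"
| "sub \<sigma> (TrEq x y) = TrEq (sub \<sigma> x) (sub \<sigma> y)"
| "sub \<sigma> (TrRec h f x) = TrRec (sub \<sigma> h) (sub \<sigma> f) (sub \<sigma> x)"
| "sub \<sigma> (FunExt f g h) = FunExt (sub \<sigma> f) (sub \<sigma> g) (sub \<sigma> h)"
| "sub \<sigma> (PropExt p q f g) = PropExt (sub \<sigma> p) (sub \<sigma> q) (sub \<sigma> f) (sub \<sigma> g)"

abbreviation inst1 :: "tm \<Rightarrow> tm \<Rightarrow> tm" where
  "inst1 B a \<equiv> sub (a \<bullet> Var) B"

text \<open>\<open>inst2 C a b\<close> puts \<open>a\<close> for index 1 and \<open>b\<close> for index 0.\<close>

abbreviation inst2 :: "tm \<Rightarrow> tm \<Rightarrow> tm \<Rightarrow> tm" where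
  "inst2 C a b \<equiv> sub (b \<bullet> a \<bullet> Var) C"

subsection \<open>Derived type formers\<close>

definition Arr :: "tm \<Rightarrow> tm \<Rightarrow> tm" (infixr "\<rightarrow>\<^sub>t" 60) where
  "A \<rightarrow>\<^sub>t B = PiT A (wk B)"

definition Times :: "tm \<Rightarrow> tm \<Rightarrow> tm" (infixr "\<times>\<^sub>t" 65) where
  "A \<times>\<^sub>t B = SigT A (wk B)"

definition Iff :: "tm \<Rightarrow> tm \<Rightarrow> tm" (infix "\<leftrightarrow>\<^sub>t" 58) where
  "A \<leftrightarrow>\<^sub>t B = (A \<rightarrow>\<^sub>t B) \<times>\<^sub>t (B \<rightarrow>\<^sub>t A)"

definition isProp :: "tm \<Rightarrow> tm" where
  "isProp A = PiT A (PiT (wk A) (IdT (wk (wk A)) (Var 1) (Var 0)))"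

subsection \<open>Judgements\<close>

text \<open>
  The head of a context is the type of the most recent variable. Congruence rules are named
  \<open>_C\<close>. Truncation comes with no judgemental computation rule: as its recursion principle
  only targets propositions, the computation rule holds up to \<open>IdT\<close> automatically.
\<close>

inductive
  ctx :: "tm list \<Rightarrow> bool" ("\<turnstile> _" [50] 50) and
  has :: "tm list \<Rightarrow> tm \<Rightarrow> tm \<Rightarrow> bool" ("_ \<turnstile> _ \<Colon> _" [50, 50, 50] 50) and
  jeq :: "tm list \<Rightarrow> tm \<Rightarrow> tm \<Rightarrow> tm \<Rightarrow> bool" ("_ \<turnstile> _ \<doteq> _ \<Colon> _" [50, 50, 50, 50] 50)
where
  ctx_Nil: "\<turnstile> []"
| ctx_Cons: "\<turnstile> \<Gamma> \<Longrightarrow> \<Gamma> \<turnstile> A \<Colon> Univ i \<Longrightarrow> \<turnstile> A # \<Gamma>"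
| Var: "\<turnstile> \<Gamma> \<Longrightarrow> n < length \<Gamma> \<Longrightarrow> \<Gamma> \<turnstile> Var n \<Colon> ren (\<lambda>k. k + Suc n) (\<Gamma> ! n)"

| Conv: "\<Gamma> \<turnstile> a \<Colon> A \<Longrightarrow> \<Gamma> \<turnstile> A \<doteq> B \<Colon> Univ i \<Longrightarrow> \<Gamma> \<turnstile> a \<Colon> B"
| Conv_eq: "\<Gamma> \<turnstile> a \<doteq> b \<Colon> A \<Longrightarrow> \<Gamma> \<turnstile> A \<doteq> B \<Colon> Univ i \<Longrightarrow> \<Gamma> \<turnstile> a \<doteq> b \<Colon> B"
| Eq_refl: "\<Gamma> \<turnstile> a \<Colon> A \<Longrightarrow> \<Gamma> \<turnstile> a \<doteq> a \<Colon> A"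
| Eq_sym: "\<Gamma> \<turnstile> a \<doteq> b \<Colon> A \<Longrightarrow> \<Gamma> \<turnstile> b \<doteq> a \<Colon> A"
| Eq_trans: "\<Gamma> \<turnstile> a \<doteq> b \<Colon> A \<Longrightarrow> \<Gamma> \<turnstile> b \<doteq> c \<Colon> A \<Longrightarrow> \<Gamma> \<turnstile> a \<doteq> c \<Colon> A"

| Univ_F: "\<turnstile> \<Gamma> \<Longrightarrow> \<Gamma> \<turnstile> Univ i \<Colon> Univ (Suc i)"
| Cumul: "\<Gamma> \<turnstile> A \<Colon> Univ i \<Longrightarrow> \<Gamma> \<turnstile> A \<Colon> Univ (Suc i)"
| Cumul_eq: "\<Gamma> \<turnstile> A \<doteq> B \<Colon> Univ i \<Longrightarrow> \<Gamma> \<turnstile> A \<doteq> B \<Colon> Univ (Suc i)"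

| Pi_F: "\<Gamma> \<turnstile> A \<Colon> Univ i \<Longrightarrow> A # \<Gamma> \<turnstile> B \<Colon> Univ i \<Longrightarrow> \<Gamma> \<turnstile> PiT A B \<Colon> Univ i"
| Pi_F_C: "\<Gamma> \<turnstile> A \<Colon> Univ i \<Longrightarrow> \<Gamma> \<turnstile> A \<doteq> A' \<Colon> Univ i \<Longrightarrow> A # \<Gamma> \<turnstile> B \<doteq> B' \<Colon> Univ i
    \<Longrightarrow> \<Gamma> \<turnstile> PiT A B \<doteq> PiT A' B' \<Colon> Univ i"
| Pi_I: "\<Gamma> \<turnstile> A \<Colon> Univ i \<Longrightarrow> A # \<Gamma> \<turnstile> b \<Colon> B \<Longrightarrow> \<Gamma> \<turnstile> Lam A b \<Colon> PiT A B"
| Pi_I_C: "\<Gamma> \<turnstile> A \<Colon> Univ i \<Longrightarrow> \<Gamma> \<turnstile> A \<doteq> A' \<Colon> Univ i \<Longrightarrow> A # \<Gamma> \<turnstile> b \<doteq> b' \<Colon> B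
    \<Longrightarrow> \<Gamma> \<turnstile> Lam A b \<doteq> Lam A' b' \<Colon> PiT A B"
| Pi_E: "\<Gamma> \<turnstile> f \<Colon> PiT A B \<Longrightarrow> \<Gamma> \<turnstile> a \<Colon> A \<Longrightarrow> \<Gamma> \<turnstile> App f a \<Colon> inst1 B a"
| Pi_E_C: "\<Gamma> \<turnstile> f \<doteq> f' \<Colon> PiT A B \<Longrightarrow> \<Gamma> \<turnstile> a \<doteq> a' \<Colon> A \<Longrightarrow> \<Gamma> \<turnstile> App f a \<doteq> App f' a' \<Colon> inst1 B a"
| Pi_beta: "\<Gamma> \<turnstile> A \<Colon> Univ i \<Longrightarrow> A # \<Gamma> \<turnstile> b \<Colon> B \<Longrightarrow> \<Gamma> \<turnstile> a \<Colon> A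
    \<Longrightarrow> \<Gamma> \<turnstile> App (Lam A b) a \<doteq> inst1 b a \<Colon> inst1 B a"
| Pi_eta: "\<Gamma> \<turnstile> f \<Colon> PiT A B \<Longrightarrow> \<Gamma> \<turnstile> f \<doteq> Lam A (App (wk f) (Var 0)) \<Colon> PiT A B"

| Sig_F: "\<Gamma> \<turnstile> A \<Colon> Univ i \<Longrightarrow> A # \<Gamma> \<turnstile> B \<Colon> Univ i \<Longrightarrow> \<Gamma> \<turnstile> SigT A B \<Colon> Univ i"
| Sig_F_C: "\<Gamma> \<turnstile> A \<Colon> Univ i \<Longrightarrow> \<Gamma> \<turnstile> A \<doteq> A' \<Colon> Univ i \<Longrightarrow> A # \<Gamma> \<turnstile> B \<doteq> B' \<Colon> Univ i
    \<Longrightarrow> \<Gamma> \<turnstile> SigT A B \<doteq> SigT A' B' \<Colon> Univ i"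
| Sig_I: "A # \<Gamma> \<turnstile> B \<Colon> Univ i \<Longrightarrow> \<Gamma> \<turnstile> a \<Colon> A \<Longrightarrow> \<Gamma> \<turnstile> b \<Colon> inst1 B a \<Longrightarrow> \<Gamma> \<turnstile> MkPair a b \<Colon> SigT A B"
| Sig_I_C: "A # \<Gamma> \<turnstile> B \<Colon> Univ i \<Longrightarrow> \<Gamma> \<turnstile> a \<doteq> a' \<Colon> A \<Longrightarrow> \<Gamma> \<turnstile> b \<doteq> b' \<Colon> inst1 B a
    \<Longrightarrow> \<Gamma> \<turnstile> MkPair a b \<doteq> MkPair a' b' \<Colon> SigT A B"
| Fst_E: "\<Gamma> \<turnstile> p \<Colon> SigT A B \<Longrightarrow> \<Gamma> \<turnstile> Fst p \<Colon> A"
| Fst_E_C: "\<Gamma> \<turnstile> p \<doteq> p' \<Colon> SigT A B \<Longrightarrow> \<Gamma> \<turnstile> Fst p \<doteq> Fst p' \<Colon> A"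
| Snd_E: "\<Gamma> \<turnstile> p \<Colon> SigT A B \<Longrightarrow> \<Gamma> \<turnstile> Snd p \<Colon> inst1 B (Fst p)"
| Snd_E_C: "\<Gamma> \<turnstile> p \<doteq> p' \<Colon> SigT A B \<Longrightarrow> \<Gamma> \<turnstile> Snd p \<doteq> Snd p' \<Colon> inst1 B (Fst p)"
| Fst_beta: "A # \<Gamma> \<turnstile> B \<Colon> Univ i \<Longrightarrow> \<Gamma> \<turnstile> a \<Colon> A \<Longrightarrow> \<Gamma> \<turnstile> b \<Colon> inst1 B a
    \<Longrightarrow> \<Gamma> \<turnstile> Fst (MkPair a b) \<doteq> a \<Colon> A"
| Snd_beta: "A # \<Gamma> \<turnstile> B \<Colon> Univ i \<Longrightarrow> \<Gamma> \<turnstile> a \<Colon> A \<Longrightarrow> \<Gamma> \<turnstile> b \<Colon> inst1 B a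
    \<Longrightarrow> \<Gamma> \<turnstile> Snd (MkPair a b) \<doteq> b \<Colon> inst1 B a"
| Sig_eta: "\<Gamma> \<turnstile> p \<Colon> SigT A B \<Longrightarrow> \<Gamma> \<turnstile> p \<doteq> MkPair (Fst p) (Snd p) \<Colon> SigT A B"

| Empty_F: "\<turnstile> \<Gamma> \<Longrightarrow> \<Gamma> \<turnstile> EmptyT \<Colon> Univ i"
| Empty_E: "EmptyT # \<Gamma> \<turnstile> C \<Colon> Univ i \<Longrightarrow> \<Gamma> \<turnstile> e \<Colon> EmptyT \<Longrightarrow> \<Gamma> \<turnstile> EmptyInd C e \<Colon> inst1 C e"
| Empty_E_C: "EmptyT # \<Gamma> \<turnstile> C \<doteq> C' \<Colon> Univ i \<Longrightarrow> \<Gamma> \<turnstile> e \<doteq> e' \<Colon> EmptyT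
    \<Longrightarrow> \<Gamma> \<turnstile> EmptyInd C e \<doteq> EmptyInd C' e' \<Colon> inst1 C e"

| Unit_F: "\<turnstile> \<Gamma> \<Longrightarrow> \<Gamma> \<turnstile> UnitT \<Colon> Univ i"
| Unit_I: "\<turnstile> \<Gamma> \<Longrightarrow> \<Gamma> \<turnstile> Star \<Colon> UnitT"
| Unit_E: "UnitT # \<Gamma> \<turnstile> C \<Colon> Univ i \<Longrightarrow> \<Gamma> \<turnstile> c \<Colon> inst1 C Star \<Longrightarrow> \<Gamma> \<turnstile> u \<Colon> UnitT
    \<Longrightarrow> \<Gamma> \<turnstile> UnitInd C c u \<Colon> inst1 C u"
| Unit_E_C: "UnitT # \<Gamma> \<turnstile> C \<doteq> C' \<Colon> Univ i \<Longrightarrow> \<Gamma> \<turnstile> c \<doteq> c' \<Colon> inst1 C Star \<Longrightarrow> \<Gamma> \<turnstile> u \<doteq> u' \<Colon> UnitT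
    \<Longrightarrow> \<Gamma> \<turnstile> UnitInd C c u \<doteq> UnitInd C' c' u' \<Colon> inst1 C u"
| Unit_beta: "UnitT # \<Gamma> \<turnstile> C \<Colon> Univ i \<Longrightarrow> \<Gamma> \<turnstile> c \<Colon> inst1 C Star
    \<Longrightarrow> \<Gamma> \<turnstile> UnitInd C c Star \<doteq> c \<Colon> inst1 C Star"

| Sum_F: "\<Gamma> \<turnstile> A \<Colon> Univ i \<Longrightarrow> \<Gamma> \<turnstile> B \<Colon> Univ i \<Longrightarrow> \<Gamma> \<turnstile> SumT A B \<Colon> Univ i"
| Sum_F_C: "\<Gamma> \<turnstile> A \<doteq> A' \<Colon> Univ i \<Longrightarrow> \<Gamma> \<turnstile> B \<doteq> B' \<Colon> Univ i \<Longrightarrow> \<Gamma> \<turnstile> SumT A B \<doteq> SumT A' B' \<Colon> Univ i"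
| InL_I: "\<Gamma> \<turnstile> B \<Colon> Univ i \<Longrightarrow> \<Gamma> \<turnstile> a \<Colon> A \<Longrightarrow> \<Gamma> \<turnstile> InL a \<Colon> SumT A B"
| InL_I_C: "\<Gamma> \<turnstile> B \<Colon> Univ i \<Longrightarrow> \<Gamma> \<turnstile> a \<doteq> a' \<Colon> A \<Longrightarrow> \<Gamma> \<turnstile> InL a \<doteq> InL a' \<Colon> SumT A B"
| InR_I: "\<Gamma> \<turnstile> A \<Colon> Univ i \<Longrightarrow> \<Gamma> \<turnstile> b \<Colon> B \<Longrightarrow> \<Gamma> \<turnstile> InR b \<Colon> SumT A B"
| InR_I_C: "\<Gamma> \<turnstile> A \<Colon> Univ i \<Longrightarrow> \<Gamma> \<turnstile> b \<doteq> b' \<Colon> B \<Longrightarrow> \<Gamma> \<turnstile> InR b \<doteq> InR b' \<Colon> SumT A B"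
| Sum_E: "SumT A B # \<Gamma> \<turnstile> C \<Colon> Univ i
    \<Longrightarrow> A # \<Gamma> \<turnstile> l \<Colon> sub (InL (Var 0) \<bullet> (\<lambda>k. Var (k + 1))) C
    \<Longrightarrow> B # \<Gamma> \<turnstile> r \<Colon> sub (InR (Var 0) \<bullet> (\<lambda>k. Var (k + 1))) C
    \<Longrightarrow> \<Gamma> \<turnstile> s \<Colon> SumT A B
    \<Longrightarrow> \<Gamma> \<turnstile> SumInd C l r s \<Colon> inst1 C s"
| Sum_E_C: "SumT A B # \<Gamma> \<turnstile> C \<doteq> C' \<Colon> Univ i
    \<Longrightarrow> A # \<Gamma> \<turnstile> l \<doteq> l' \<Colon> sub (InL (Var 0) \<bullet> (\<lambda>k. Var (k + 1))) C
    \<Longrightarrow> B # \<Gamma> \<turnstile> r \<doteq> r' \<Colon> sub (InR (Var 0) \<bullet> (\<lambda>k. Var (k + 1))) C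
    \<Longrightarrow> \<Gamma> \<turnstile> s \<doteq> s' \<Colon> SumT A B
    \<Longrightarrow> \<Gamma> \<turnstile> SumInd C l r s \<doteq> SumInd C' l' r' s' \<Colon> inst1 C s"
| InL_beta: "SumT A B # \<Gamma> \<turnstile> C \<Colon> Univ i
    \<Longrightarrow> A # \<Gamma> \<turnstile> l \<Colon> sub (InL (Var 0) \<bullet> (\<lambda>k. Var (k + 1))) C
    \<Longrightarrow> B # \<Gamma> \<turnstile> r \<Colon> sub (InR (Var 0) \<bullet> (\<lambda>k. Var (k + 1))) C
    \<Longrightarrow> \<Gamma> \<turnstile> a \<Colon> A
    \<Longrightarrow> \<Gamma> \<turnstile> SumInd C l r (InL a) \<doteq> inst1 l a \<Colon> inst1 C (InL a)"
| InR_beta: "SumT A B # \<Gamma> \<turnstile> C \<Colon> Univ i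
    \<Longrightarrow> A # \<Gamma> \<turnstile> l \<Colon> sub (InL (Var 0) \<bullet> (\<lambda>k. Var (k + 1))) C
    \<Longrightarrow> B # \<Gamma> \<turnstile> r \<Colon> sub (InR (Var 0) \<bullet> (\<lambda>k. Var (k + 1))) C
    \<Longrightarrow> \<Gamma> \<turnstile> b \<Colon> B
    \<Longrightarrow> \<Gamma> \<turnstile> SumInd C l r (InR b) \<doteq> inst1 r b \<Colon> inst1 C (InR b)"

| Two_F: "\<turnstile> \<Gamma> \<Longrightarrow> \<Gamma> \<turnstile> TwoT \<Colon> Univ i"
| Two0_I: "\<turnstile> \<Gamma> \<Longrightarrow> \<Gamma> \<turnstile> Two0 \<Colon> TwoT"
| Two1_I: "\<turnstile> \<Gamma> \<Longrightarrow> \<Gamma> \<turnstile> Two1 \<Colon> TwoT"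
| Two_E: "TwoT # \<Gamma> \<turnstile> C \<Colon> Univ i \<Longrightarrow> \<Gamma> \<turnstile> c \<Colon> inst1 C Two0 \<Longrightarrow> \<Gamma> \<turnstile> d \<Colon> inst1 C Two1 \<Longrightarrow> \<Gamma> \<turnstile> b \<Colon> TwoT
    \<Longrightarrow> \<Gamma> \<turnstile> TwoInd C c d b \<Colon> inst1 C b"
| Two_E_C: "TwoT # \<Gamma> \<turnstile> C \<doteq> C' \<Colon> Univ i \<Longrightarrow> \<Gamma> \<turnstile> c \<doteq> c' \<Colon> inst1 C Two0
    \<Longrightarrow> \<Gamma> \<turnstile> d \<doteq> d' \<Colon> inst1 C Two1 \<Longrightarrow> \<Gamma> \<turnstile> b \<doteq> b' \<Colon> TwoT
    \<Longrightarrow> \<Gamma> \<turnstile> TwoInd C c d b \<doteq> TwoInd C' c' d' b' \<Colon> inst1 C b"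
| Two0_beta: "TwoT # \<Gamma> \<turnstile> C \<Colon> Univ i \<Longrightarrow> \<Gamma> \<turnstile> c \<Colon> inst1 C Two0 \<Longrightarrow> \<Gamma> \<turnstile> d \<Colon> inst1 C Two1
    \<Longrightarrow> \<Gamma> \<turnstile> TwoInd C c d Two0 \<doteq> c \<Colon> inst1 C Two0"
| Two1_beta: "TwoT # \<Gamma> \<turnstile> C \<Colon> Univ i \<Longrightarrow> \<Gamma> \<turnstile> c \<Colon> inst1 C Two0 \<Longrightarrow> \<Gamma> \<turnstile> d \<Colon> inst1 C Two1
    \<Longrightarrow> \<Gamma> \<turnstile> TwoInd C c d Two1 \<doteq> d \<Colon> inst1 C Two1"

| Nat_F: "\<turnstile> \<Gamma> \<Longrightarrow> \<Gamma> \<turnstile> NatT \<Colon> Univ i"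
| Zero_I: "\<turnstile> \<Gamma> \<Longrightarrow> \<Gamma> \<turnstile> Zero \<Colon> NatT"
| Succ_I: "\<Gamma> \<turnstile> n \<Colon> NatT \<Longrightarrow> \<Gamma> \<turnstile> Succ n \<Colon> NatT"
| Succ_I_C: "\<Gamma> \<turnstile> n \<doteq> n' \<Colon> NatT \<Longrightarrow> \<Gamma> \<turnstile> Succ n \<doteq> Succ n' \<Colon> NatT"
| Nat_E: "NatT # \<Gamma> \<turnstile> C \<Colon> Univ i \<Longrightarrow> \<Gamma> \<turnstile> z \<Colon> inst1 C Zero
    \<Longrightarrow> C # NatT # \<Gamma> \<turnstile> s \<Colon> sub (Succ (Var 1) \<bullet> (\<lambda>k. Var (k + 2))) C \<Longrightarrow> \<Gamma> \<turnstile> n \<Colon> NatT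
    \<Longrightarrow> \<Gamma> \<turnstile> NatInd C z s n \<Colon> inst1 C n"
| Nat_E_C: "NatT # \<Gamma> \<turnstile> C \<Colon> Univ i \<Longrightarrow> NatT # \<Gamma> \<turnstile> C \<doteq> C' \<Colon> Univ i \<Longrightarrow> \<Gamma> \<turnstile> z \<doteq> z' \<Colon> inst1 C Zero
    \<Longrightarrow> C # NatT # \<Gamma> \<turnstile> s \<doteq> s' \<Colon> sub (Succ (Var 1) \<bullet> (\<lambda>k. Var (k + 2))) C \<Longrightarrow> \<Gamma> \<turnstile> n \<doteq> n' \<Colon> NatT
    \<Longrightarrow> \<Gamma> \<turnstile> NatInd C z s n \<doteq> NatInd C' z' s' n' \<Colon> inst1 C n"
| Zero_beta: "NatT # \<Gamma> \<turnstile> C \<Colon> Univ i \<Longrightarrow> \<Gamma> \<turnstile> z \<Colon> inst1 C Zero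
    \<Longrightarrow> C # NatT # \<Gamma> \<turnstile> s \<Colon> sub (Succ (Var 1) \<bullet> (\<lambda>k. Var (k + 2))) C
    \<Longrightarrow> \<Gamma> \<turnstile> NatInd C z s Zero \<doteq> z \<Colon> inst1 C Zero"
| Succ_beta: "NatT # \<Gamma> \<turnstile> C \<Colon> Univ i \<Longrightarrow> \<Gamma> \<turnstile> z \<Colon> inst1 C Zero
    \<Longrightarrow> C # NatT # \<Gamma> \<turnstile> s \<Colon> sub (Succ (Var 1) \<bullet> (\<lambda>k. Var (k + 2))) C \<Longrightarrow> \<Gamma> \<turnstile> n \<Colon> NatT
    \<Longrightarrow> \<Gamma> \<turnstile> NatInd C z s (Succ n) \<doteq> inst2 s n (NatInd C z s n) \<Colon> inst1 C (Succ n)"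

| Id_F: "\<Gamma> \<turnstile> A \<Colon> Univ i \<Longrightarrow> \<Gamma> \<turnstile> a \<Colon> A \<Longrightarrow> \<Gamma> \<turnstile> b \<Colon> A \<Longrightarrow> \<Gamma> \<turnstile> IdT A a b \<Colon> Univ i"
| Id_F_C: "\<Gamma> \<turnstile> A \<doteq> A' \<Colon> Univ i \<Longrightarrow> \<Gamma> \<turnstile> a \<doteq> a' \<Colon> A \<Longrightarrow> \<Gamma> \<turnstile> b \<doteq> b' \<Colon> A
    \<Longrightarrow> \<Gamma> \<turnstile> IdT A a b \<doteq> IdT A' a' b' \<Colon> Univ i"
| Id_I: "\<Gamma> \<turnstile> a \<Colon> A \<Longrightarrow> \<Gamma> \<turnstile> Refl a \<Colon> IdT A a a"
| Id_I_C: "\<Gamma> \<turnstile> a \<doteq> a' \<Colon> A \<Longrightarrow> \<Gamma> \<turnstile> Refl a \<doteq> Refl a' \<Colon> IdT A a a"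
| Id_E: "IdT (wk A) (wk a) (Var 0) # A # \<Gamma> \<turnstile> C \<Colon> Univ i \<Longrightarrow> \<Gamma> \<turnstile> a \<Colon> A \<Longrightarrow> \<Gamma> \<turnstile> d \<Colon> inst2 C a (Refl a)
    \<Longrightarrow> \<Gamma> \<turnstile> b \<Colon> A \<Longrightarrow> \<Gamma> \<turnstile> p \<Colon> IdT A a b
    \<Longrightarrow> \<Gamma> \<turnstile> J C d p \<Colon> inst2 C b p"
| Id_E_C: "IdT (wk A) (wk a) (Var 0) # A # \<Gamma> \<turnstile> C \<doteq> C' \<Colon> Univ i \<Longrightarrow> \<Gamma> \<turnstile> a \<Colon> A
    \<Longrightarrow> \<Gamma> \<turnstile> d \<doteq> d' \<Colon> inst2 C a (Refl a) \<Longrightarrow> \<Gamma> \<turnstile> b \<Colon> A \<Longrightarrow> \<Gamma> \<turnstile> p \<doteq> p' \<Colon> IdT A a b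
    \<Longrightarrow> \<Gamma> \<turnstile> J C d p \<doteq> J C' d' p' \<Colon> inst2 C b p"
| Id_beta: "IdT (wk A) (wk a) (Var 0) # A # \<Gamma> \<turnstile> C \<Colon> Univ i \<Longrightarrow> \<Gamma> \<turnstile> a \<Colon> A
    \<Longrightarrow> \<Gamma> \<turnstile> d \<Colon> inst2 C a (Refl a)
    \<Longrightarrow> \<Gamma> \<turnstile> J C d (Refl a) \<doteq> d \<Colon> inst2 C a (Refl a)"

| Trunc_F: "\<Gamma> \<turnstile> A \<Colon> Univ i \<Longrightarrow> \<Gamma> \<turnstile> Trunc A \<Colon> Univ i"
| Trunc_F_C: "\<Gamma> \<turnstile> A \<doteq> A' \<Colon> Univ i \<Longrightarrow> \<Gamma> \<turnstile> Trunc A \<doteq> Trunc A' \<Colon> Univ i"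
| Trunc_I: "\<Gamma> \<turnstile> a \<Colon> A \<Longrightarrow> \<Gamma> \<turnstile> TrIn a \<Colon> Trunc A"
| Trunc_I_C: "\<Gamma> \<turnstile> a \<doteq> a' \<Colon> A \<Longrightarrow> \<Gamma> \<turnstile> TrIn a \<doteq> TrIn a' \<Colon> Trunc A"
| Trunc_prop: "\<Gamma> \<turnstile> x \<Colon> Trunc A \<Longrightarrow> \<Gamma> \<turnstile> y \<Colon> Trunc A \<Longrightarrow> \<Gamma> \<turnstile> TrEq x y \<Colon> IdT (Trunc A) x y"
| Trunc_prop_C: "\<Gamma> \<turnstile> x \<doteq> x' \<Colon> Trunc A \<Longrightarrow> \<Gamma> \<turnstile> y \<doteq> y' \<Colon> Trunc A
    \<Longrightarrow> \<Gamma> \<turnstile> TrEq x y \<doteq> TrEq x' y' \<Colon> IdT (Trunc A) x y"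
| Trunc_E: "\<Gamma> \<turnstile> B \<Colon> Univ i \<Longrightarrow> \<Gamma> \<turnstile> h \<Colon> isProp B \<Longrightarrow> \<Gamma> \<turnstile> f \<Colon> A \<rightarrow>\<^sub>t B \<Longrightarrow> \<Gamma> \<turnstile> x \<Colon> Trunc A
    \<Longrightarrow> \<Gamma> \<turnstile> TrRec h f x \<Colon> B"
| Trunc_E_C: "\<Gamma> \<turnstile> B \<Colon> Univ i \<Longrightarrow> \<Gamma> \<turnstile> h \<doteq> h' \<Colon> isProp B \<Longrightarrow> \<Gamma> \<turnstile> f \<doteq> f' \<Colon> A \<rightarrow>\<^sub>t B
    \<Longrightarrow> \<Gamma> \<turnstile> x \<doteq> x' \<Colon> Trunc A \<Longrightarrow> \<Gamma> \<turnstile> TrRec h f x \<doteq> TrRec h' f' x' \<Colon> B"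

| FunExt: "\<Gamma> \<turnstile> f \<Colon> PiT A B \<Longrightarrow> \<Gamma> \<turnstile> g \<Colon> PiT A B
    \<Longrightarrow> \<Gamma> \<turnstile> h \<Colon> PiT A (IdT B (App (wk f) (Var 0)) (App (wk g) (Var 0)))
    \<Longrightarrow> \<Gamma> \<turnstile> FunExt f g h \<Colon> IdT (PiT A B) f g"
| FunExt_C: "\<Gamma> \<turnstile> f \<doteq> f' \<Colon> PiT A B \<Longrightarrow> \<Gamma> \<turnstile> g \<doteq> g' \<Colon> PiT A B
    \<Longrightarrow> \<Gamma> \<turnstile> h \<doteq> h' \<Colon> PiT A (IdT B (App (wk f) (Var 0)) (App (wk g) (Var 0)))
    \<Longrightarrow> \<Gamma> \<turnstile> FunExt f g h \<doteq> FunExt f' g' h' \<Colon> IdT (PiT A B) f g"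
| PropExt: "\<Gamma> \<turnstile> P \<Colon> Univ i \<Longrightarrow> \<Gamma> \<turnstile> Q \<Colon> Univ i \<Longrightarrow> \<Gamma> \<turnstile> p \<Colon> isProp P \<Longrightarrow> \<Gamma> \<turnstile> q \<Colon> isProp Q
    \<Longrightarrow> \<Gamma> \<turnstile> f \<Colon> P \<rightarrow>\<^sub>t Q \<Longrightarrow> \<Gamma> \<turnstile> g \<Colon> Q \<rightarrow>\<^sub>t P
    \<Longrightarrow> \<Gamma> \<turnstile> PropExt p q f g \<Colon> IdT (Univ i) P Q"
| PropExt_C: "\<Gamma> \<turnstile> P \<Colon> Univ i \<Longrightarrow> \<Gamma> \<turnstile> Q \<Colon> Univ i \<Longrightarrow> \<Gamma> \<turnstile> p \<doteq> p' \<Colon> isProp P \<Longrightarrow> \<Gamma> \<turnstile> q \<doteq> q' \<Colon> isProp Q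
    \<Longrightarrow> \<Gamma> \<turnstile> f \<doteq> f' \<Colon> P \<rightarrow>\<^sub>t Q \<Longrightarrow> \<Gamma> \<turnstile> g \<doteq> g' \<Colon> Q \<rightarrow>\<^sub>t P
    \<Longrightarrow> \<Gamma> \<turnstile> PropExt p q f g \<doteq> PropExt p' q' f' g' \<Colon> IdT (Univ i) P Q"

subsection \<open>Rosolini propositions and the two choice principles\<close>

text \<open>\<open>isOne \<alpha> n\<close> is the type \<open>\<alpha>\<^sub>n = 1\<close>, and \<open>angle \<alpha>\<close> is \<open>\<langle>\<alpha>\<rangle>\<close>.\<close>

definition isOne :: "tm \<Rightarrow> tm \<Rightarrow> tm" where
  "isOne \<alpha> n = IdT TwoT (App \<alpha> n) Two1"

definition angle :: "tm \<Rightarrow> tm" where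
  "angle \<alpha> = SigT NatT (isOne (wk \<alpha>) (Var 0))"

definition Ninf :: tm where
  "Ninf = SigT (NatT \<rightarrow>\<^sub>t TwoT) (isProp (angle (Var 0)))"

text \<open>For \<open>u : Ninf\<close>, the type \<open>\<langle>u\<rangle>\<close> is that of the underlying sequence.\<close>

definition isRosolini :: "nat \<Rightarrow> tm \<Rightarrow> tm" where
  "isRosolini i P = Trunc (SigT Ninf (IdT (Univ i) (wk P) (angle (Fst (Var 0)))))"

text \<open>Under the binders, \<open>\<alpha>\<close> is \<open>Var 1\<close> and \<open>n\<close> is \<open>Var 0\<close>.\<close>

definition sequence_choice :: "tm \<Rightarrow> tm" where
  "sequence_choice A =
    PiT (NatT \<rightarrow>\<^sub>t TwoT)
      (PiT NatT (Trunc (isOne (Var 1) (Var 0) \<rightarrow>\<^sub>t wk (wk A)))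
        \<rightarrow>\<^sub>t Trunc (PiT NatT (isOne (Var 1) (Var 0) \<rightarrow>\<^sub>t wk (wk A))))"

definition Rosolini_choice :: "nat \<Rightarrow> tm \<Rightarrow> tm" where
  "Rosolini_choice i A =
    PiT (Univ i)
      (isProp (Var 0) \<rightarrow>\<^sub>t isRosolini i (Var 0)
        \<rightarrow>\<^sub>t (Var 0 \<rightarrow>\<^sub>t Trunc (wk A)) \<rightarrow>\<^sub>t Trunc (Var 0 \<rightarrow>\<^sub>t wk A))"

end

theory Submission
  imports Defs
begin

text \<open>
  From (1) to (2): a Rosolini proposition is \<open>P = \<langle>\<alpha>\<rangle>\<close>, so \<open>P \<rightarrow> \<parallel>A\<parallel>\<close> yields
  \<open>(\<alpha>\<^sub>n = 1) \<rightarrow> \<parallel>A\<parallel>\<close> for each \<open>n\<close>; as \<open>\<alpha>\<^sub>n = 1\<close> is decidable the truncation moves outside, and (1)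
  gives a map \<open>\<langle>\<alpha>\<rangle> \<rightarrow> A\<close> up to truncation. From (2) to (1): let \<open>\<beta>\<^sub>n = 1\<close> hold exactly at
  the first \<open>n\<close> with \<open>\<alpha>\<^sub>n = 1\<close>. Then \<open>\<langle>\<beta>\<rangle>\<close> is a proposition, so (2) applies to it, and
  \<open>\<alpha>\<^sub>n = 1\<close> implies \<open>\<langle>\<beta>\<rangle>\<close> implies some \<open>\<alpha>\<^sub>m = 1\<close>.

  All derivations are closed terms. Lemmas whose proof needs path induction, a judgemental
  equality or a dependent pair are derived by hand; the others are explicit terms over these lemmas
  as hypotheses, and are type-checked by rewriting with a verified inference function.
\<close>

section \<open>Higher-order notation for terms\<close>

text \<open>A term is represented as a function of the number of binders above it, so that a bound
  variable is a HOL variable: a variable bound at depth \<open>d\<close> has index \<open>e - Suc d\<close> at depth \<open>e\<close>.\<close>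

type_synonym ptm = "nat \<Rightarrow> tm"

definition bv :: "nat \<Rightarrow> ptm" where "bv d = (\<lambda>e. Var (e - Suc d))"

definition pi :: "ptm \<Rightarrow> (ptm \<Rightarrow> ptm) \<Rightarrow> ptm" where
  "pi A F = (\<lambda>d. PiT (A d) (F (bv d) (Suc d)))"
definition lam :: "ptm \<Rightarrow> (ptm \<Rightarrow> ptm) \<Rightarrow> ptm" where
  "lam A F = (\<lambda>d. Lam (A d) (F (bv d) (Suc d)))"
text \<open>The codomain is evaluated at the outer depth; the shift past the domain is the
  \<open>wk\<close> inside \<open>Arr\<close>.\<close>

definition arr :: "ptm \<Rightarrow> ptm \<Rightarrow> ptm" (infixr "\<rightarrow>\<^sub>h" 60) where
  "(A \<rightarrow>\<^sub>h B) = (\<lambda>d. A d \<rightarrow>\<^sub>t B d)"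
definition app :: "ptm \<Rightarrow> ptm \<Rightarrow> ptm" (infixl "\<cdot>" 90) where
  "f \<cdot> a = (\<lambda>d. App (f d) (a d))"
definition uni :: "nat \<Rightarrow> ptm" where "uni i = (\<lambda>d. Univ i)"
definition two :: ptm where "two = (\<lambda>d. TwoT)"
definition zero2 :: ptm where "zero2 = (\<lambda>d. Two0)"
definition one2 :: ptm where "one2 = (\<lambda>d. Two1)"
definition twoind :: "(ptm \<Rightarrow> ptm) \<Rightarrow> ptm \<Rightarrow> ptm \<Rightarrow> ptm \<Rightarrow> ptm" where
  "twoind C c e b = (\<lambda>d. TwoInd (C (bv d) (Suc d)) (c d) (e d) (b d))"
definition nats :: ptm where "nats = (\<lambda>d. NatT)"
definition nzero :: ptm where "nzero = (\<lambda>d. Zero)"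
definition nsuc :: "ptm \<Rightarrow> ptm" where "nsuc n = (\<lambda>d. Succ (n d))"
definition natind :: "(ptm \<Rightarrow> ptm) \<Rightarrow> ptm \<Rightarrow> (ptm \<Rightarrow> ptm \<Rightarrow> ptm) \<Rightarrow> ptm \<Rightarrow> ptm" where
  "natind C z s n = (\<lambda>d. NatInd (C (bv d) (Suc d)) (z d) (s (bv d) (bv (Suc d)) (Suc (Suc d))) (n d))"
definition eq :: "ptm \<Rightarrow> ptm \<Rightarrow> ptm \<Rightarrow> ptm" where
  "eq A a b = (\<lambda>d. IdT (A d) (a d) (b d))"
definition rfl :: "ptm \<Rightarrow> ptm" where "rfl a = (\<lambda>d. Refl (a d))"
definition trunc :: "ptm \<Rightarrow> ptm" where "trunc A = (\<lambda>d. Trunc (A d))"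
definition trin :: "ptm \<Rightarrow> ptm" where "trin A = (\<lambda>d. TrIn (A d))"
definition sig :: "ptm \<Rightarrow> (ptm \<Rightarrow> ptm) \<Rightarrow> ptm" where
  "sig A F = (\<lambda>d. SigT (A d) (F (bv d) (Suc d)))"
definition pfst :: "ptm \<Rightarrow> ptm" where "pfst p = (\<lambda>d. Fst (p d))"
definition psnd :: "ptm \<Rightarrow> ptm" where "psnd p = (\<lambda>d. Snd (p d))"

definition seq :: ptm where "seq = nats \<rightarrow>\<^sub>h two"
definition one :: "ptm \<Rightarrow> ptm" where "one b = eq two b one2"
definition ang :: "ptm \<Rightarrow> ptm" where "ang \<alpha> = (\<lambda>d. angle (\<alpha> d))"
definition isprop :: "ptm \<Rightarrow> ptm" where "isprop A = (\<lambda>d. isProp (A d))"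

lemmas hoas = bv_def pi_def sig_def lam_def arr_def app_def uni_def two_def zero2_def one2_def
  twoind_def nats_def nzero_def nsuc_def natind_def eq_def rfl_def trunc_def trin_def
  pfst_def psnd_def seq_def one_def ang_def isprop_def
  Arr_def Times_def Iff_def isProp_def isOne_def angle_def Ninf_def isRosolini_def

section \<open>Evaluating substitutions at concrete indices\<close>

lemma scons_simps [simp]:
  "(a \<bullet> \<sigma>) 0 = a" "(a \<bullet> \<sigma>) (Suc n) = \<sigma> n" "(a \<bullet> \<sigma>) (numeral k) = \<sigma> (pred_numeral k)"
  by (simp_all add: scons_def numeral_eq_Suc)

lemma upr_simps [simp]:
  "upr \<rho> 0 = 0" "upr \<rho> (Suc n) = Suc (\<rho> n)" "upr \<rho> (numeral k) = Suc (\<rho> (pred_numeral k))"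
  by (simp_all add: upr_def)

lemma ups_simps [simp]:
  "ups \<sigma> 0 = Var 0" "ups \<sigma> (Suc n) = wk (\<sigma> n)" "ups \<sigma> (numeral k) = wk (\<sigma> (pred_numeral k))"
  by (simp_all add: ups_def)

lemma ups_comp_upr: "ups \<sigma> \<circ> upr \<rho> = ups (\<sigma> \<circ> \<rho>)"
  by (rule ext) (simp add: ups_def upr_def scons_def split: nat.split)

lemma ups_Var [simp]: "ups Var = Var"
  by (rule ext) (simp add: ups_def scons_def split: nat.split)

lemma sub_ren: "sub \<sigma> (ren \<rho> t) = sub (\<sigma> \<circ> \<rho>) t"
  by (induction t arbitrary: \<sigma> \<rho>) (simp_all add: ups_comp_upr)

lemma sub_Var [simp]: "sub Var t = t"
  by (induction t) simp_all

lemma sub_wk [simp]: "sub (a \<bullet> \<sigma>) (wk t) = sub \<sigma> t"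
proof -
  have "(a \<bullet> \<sigma>) \<circ> Suc = \<sigma>" by (rule ext) simp
  then show ?thesis by (simp add: sub_ren)
qed

section \<open>Syntax-directed type inference\<close>

primrec level :: "tm option \<Rightarrow> nat option" where
  "level None = None"
| "level (Some T) = (case T of Univ i \<Rightarrow> Some i | _ \<Rightarrow> None)"

fun pi_parts :: "tm option \<Rightarrow> (tm \<times> tm) option" where
  "pi_parts (Some (PiT A B)) = Some (A, B)"
| "pi_parts _ = None"

fun sig_parts :: "tm option \<Rightarrow> (tm \<times> tm) option" where
  "sig_parts (Some (SigT A B)) = Some (A, B)"
| "sig_parts _ = None"

text \<open>Types are not compared up to judgemental equality: besides syntactic identity only the inclusions between universes are recognised.\<close>

fun subtype :: "tm \<Rightarrow> tm \<Rightarrow> bool" where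
  "subtype (Univ i) (Univ j) \<longleftrightarrow> i \<le> j"
| "subtype A B \<longleftrightarrow> A = B"

definition infers :: "tm option \<Rightarrow> tm \<Rightarrow> bool" where
  "infers S T \<longleftrightarrow> (case S of None \<Rightarrow> False | Some S' \<Rightarrow> subtype S' T)"

text \<open>Only soundness is claimed, so \<open>None\<close> is always a safe answer:
  \<open>MkPair\<close>, for instance, does not record the family of its second component. The
  closed base types start at \<open>Univ 0\<close> and reach higher levels through
  \<open>subtype\<close>.\<close>

primrec infer :: "tm \<Rightarrow> tm list \<Rightarrow> tm option" where
  "infer (Var n) \<Gamma> = (if n < length \<Gamma> then Some (ren (\<lambda>k. k + Suc n) (\<Gamma> ! n)) else None)"
| "infer (Univ i) \<Gamma> = Some (Univ (Suc i))"
| "infer (PiT A B) \<Gamma> = (case level (infer A \<Gamma>) of None \<Rightarrow> None | Some i \<Rightarrow>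
    (case level (infer B (A # \<Gamma>)) of None \<Rightarrow> None | Some j \<Rightarrow> Some (Univ (max i j))))"
| "infer (Lam A b) \<Gamma> = (case level (infer A \<Gamma>) of None \<Rightarrow> None | Some i \<Rightarrow>
    (case infer b (A # \<Gamma>) of None \<Rightarrow> None | Some B \<Rightarrow> Some (PiT A B)))"
| "infer (App f a) \<Gamma> = (case pi_parts (infer f \<Gamma>) of None \<Rightarrow> None | Some (A, B) \<Rightarrow>
    (if infers (infer a \<Gamma>) A then Some (inst1 B a) else None))"
| "infer (SigT A B) \<Gamma> = (case level (infer A \<Gamma>) of None \<Rightarrow> None | Some i \<Rightarrow>
    (case level (infer B (A # \<Gamma>)) of None \<Rightarrow> None | Some j \<Rightarrow> Some (Univ (max i j))))"
| "infer (MkPair a b) \<Gamma> = None"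
| "infer (Fst p) \<Gamma> = (case sig_parts (infer p \<Gamma>) of None \<Rightarrow> None | Some (A, B) \<Rightarrow> Some A)"
| "infer (Snd p) \<Gamma> = (case sig_parts (infer p \<Gamma>) of None \<Rightarrow> None | Some (A, B) \<Rightarrow> Some (inst1 B (Fst p)))"
| "infer EmptyT \<Gamma> = Some (Univ 0)"
| "infer (EmptyInd C e) \<Gamma> = None"
| "infer UnitT \<Gamma> = Some (Univ 0)"
| "infer Star \<Gamma> = Some UnitT"
| "infer (UnitInd C c u) \<Gamma> = None"
| "infer (SumT A B) \<Gamma> = None"
| "infer (InL a) \<Gamma> = None"
| "infer (InR b) \<Gamma> = None"
| "infer (SumInd C l r s) \<Gamma> = None"
| "infer TwoT \<Gamma> = Some (Univ 0)"
| "infer Two0 \<Gamma> = Some TwoT"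
| "infer Two1 \<Gamma> = Some TwoT"
| "infer (TwoInd C c d b) \<Gamma> = (case level (infer C (TwoT # \<Gamma>)) of None \<Rightarrow> None | Some i \<Rightarrow>
    (if infers (infer c \<Gamma>) (inst1 C Two0) \<and> infers (infer d \<Gamma>) (inst1 C Two1)
      \<and> infers (infer b \<Gamma>) TwoT then Some (inst1 C b) else None))"
| "infer NatT \<Gamma> = Some (Univ 0)"
| "infer Zero \<Gamma> = Some NatT"
| "infer (Succ n) \<Gamma> = (if infers (infer n \<Gamma>) NatT then Some NatT else None)"
| "infer (NatInd C z s n) \<Gamma> = (case level (infer C (NatT # \<Gamma>)) of None \<Rightarrow> None | Some i \<Rightarrow>
    (if infers (infer z \<Gamma>) (inst1 C Zero)
      \<and> infers (infer s (C # NatT # \<Gamma>)) (sub (Succ (Var 1) \<bullet> (\<lambda>k. Var (k + 2))) C)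
      \<and> infers (infer n \<Gamma>) NatT then Some (inst1 C n) else None))"
| "infer (IdT A a b) \<Gamma> = (case level (infer A \<Gamma>) of None \<Rightarrow> None | Some i \<Rightarrow>
    (if infers (infer a \<Gamma>) A \<and> infers (infer b \<Gamma>) A then Some (Univ i) else None))"
| "infer (Refl a) \<Gamma> = (case infer a \<Gamma> of None \<Rightarrow> None | Some A \<Rightarrow> Some (IdT A a a))"
| "infer (J C d p) \<Gamma> = None"
| "infer (Trunc A) \<Gamma> = (case level (infer A \<Gamma>) of None \<Rightarrow> None | Some i \<Rightarrow> Some (Univ i))"
| "infer (TrIn a) \<Gamma> = (case infer a \<Gamma> of None \<Rightarrow> None | Some A \<Rightarrow> Some (Trunc A))"
| "infer (TrEq x y) \<Gamma> = None"
| "infer (TrRec h f x) \<Gamma> = None"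
| "infer (FunExt f g h) \<Gamma> = None"
| "infer (PropExt p q f g) \<Gamma> = None"

lemma has_cumul: "\<Gamma> \<turnstile> A \<Colon> Univ i \<Longrightarrow> i \<le> j \<Longrightarrow> \<Gamma> \<turnstile> A \<Colon> Univ j"
  by (induction j) (auto simp: le_Suc_eq intro: Cumul)

lemma level_Some: "level S = Some i \<longleftrightarrow> S = Some (Univ i)"
  by (cases S) (auto split: tm.splits)

lemma pi_parts_Some: "pi_parts S = Some (A, B) \<longleftrightarrow> S = Some (PiT A B)"
  by (induction S rule: pi_parts.induct) auto

lemma sig_parts_Some: "sig_parts S = Some (A, B) \<longleftrightarrow> S = Some (SigT A B)"
  by (induction S rule: sig_parts.induct) auto

lemma has_subtype: "\<Gamma> \<turnstile> a \<Colon> S \<Longrightarrow> subtype S T \<Longrightarrow> \<Gamma> \<turnstile> a \<Colon> T"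
  by (induction S T rule: subtype.induct) (auto intro: has_cumul)

lemma infers_sound:
  assumes "infers S T" and "\<And>S'. S = Some S' \<Longrightarrow> \<Gamma> \<turnstile> a \<Colon> S'"
  shows "\<Gamma> \<turnstile> a \<Colon> T"
  using assms by (auto simp: infers_def split: option.splits intro: has_subtype)

text \<open>Each case applies the typing rule of the head constructor. Under a binder the induction
  hypothesis asks for a well-formed extended context, which the typing of the domain supplies; the
  two levels of a \<open>PiT\<close> or \<open>SigT\<close> are raised to their maximum because the
  formation rules want a common universe.\<close>

lemma infer_sound: "infer t \<Gamma> = Some T \<Longrightarrow> \<turnstile> \<Gamma> \<Longrightarrow> \<Gamma> \<turnstile> t \<Colon> T"
proof (induction t arbitrary: \<Gamma> T)
  case (PiT A B)
  then obtain i j where ij: "infer A \<Gamma> = Some (Univ i)" "infer B (A # \<Gamma>) = Some (Univ j)"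
    and T: "T = Univ (max i j)" by (auto simp: level_Some split: option.splits)
  with PiT have A: "\<Gamma> \<turnstile> A \<Colon> Univ i" by blast
  moreover have "A # \<Gamma> \<turnstile> B \<Colon> Univ j" using PiT ij ctx_Cons[OF PiT.prems(2) A] by blast
  ultimately show ?case unfolding T by (auto intro!: Pi_F intro: has_cumul)
next
  case (SigT A B)
  then obtain i j where ij: "infer A \<Gamma> = Some (Univ i)" "infer B (A # \<Gamma>) = Some (Univ j)"
    and T: "T = Univ (max i j)" by (auto simp: level_Some split: option.splits)
  with SigT have A: "\<Gamma> \<turnstile> A \<Colon> Univ i" by blast
  moreover have "A # \<Gamma> \<turnstile> B \<Colon> Univ j" using SigT ij ctx_Cons[OF SigT.prems(2) A] by blast
  ultimately show ?case unfolding T by (auto intro!: Sig_F intro: has_cumul)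
next
  case (Lam A b)
  then obtain i B where ij: "infer A \<Gamma> = Some (Univ i)" "infer b (A # \<Gamma>) = Some B"
    and T: "T = PiT A B" by (auto simp: level_Some split: option.splits)
  with Lam have A: "\<Gamma> \<turnstile> A \<Colon> Univ i" by blast
  moreover have "A # \<Gamma> \<turnstile> b \<Colon> B" using Lam ij ctx_Cons[OF Lam.prems(2) A] by blast
  ultimately show ?case unfolding T by (rule Pi_I)
next
  case (App f a)
  then obtain A B where f: "infer f \<Gamma> = Some (PiT A B)" and a: "infers (infer a \<Gamma>) A"
    and T: "T = inst1 B a" by (auto simp: pi_parts_Some split: option.splits if_splits)
  show ?case unfolding T
    using App.IH App.prems(2) f by (intro Pi_E[where A = A] infers_sound[OF a]) auto
next
  case (TwoInd C c d b)
  have "\<turnstile> TwoT # \<Gamma>" using TwoInd.prems(2) by (blast intro: ctx_Cons Two_F)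
  with TwoInd show ?case
    by (auto simp: level_Some split: option.splits if_splits intro!: Two_E intro: infers_sound)
next
  case (NatInd C z s n)
  have N: "\<turnstile> NatT # \<Gamma>" using NatInd.prems(2) by (blast intro: ctx_Cons Nat_F)
  obtain i where i: "infer C (NatT # \<Gamma>) = Some (Univ i)"
    and z: "infers (infer z \<Gamma>) (inst1 C Zero)"
    and s: "infers (infer s (C # NatT # \<Gamma>)) (sub (Succ (Var 1) \<bullet> (\<lambda>k. Var (k + 2))) C)"
    and n: "infers (infer n \<Gamma>) NatT" and T: "T = inst1 C n"
    using NatInd.prems by (auto simp: level_Some split: option.splits if_splits)
  have C: "NatT # \<Gamma> \<turnstile> C \<Colon> Univ i" using NatInd i N by blast
  show ?case unfolding T
    using NatInd.IH NatInd.prems(2) ctx_Cons[OF N C]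
    by (intro Nat_E[OF C] infers_sound[OF z] infers_sound[OF s] infers_sound[OF n]) auto
next
  case (Var n)
  then show ?case using ctx_has_jeq.Var[of \<Gamma> n] by (auto split: if_splits)
next
  case (IdT A a b)
  then show ?case
    by (auto simp: level_Some split: option.splits if_splits intro!: Id_F intro: infers_sound)
next
  case (Fst p)
  then show ?case by (fastforce simp: sig_parts_Some split: option.splits intro: Fst_E)
next
  case (Snd p)
  then show ?case by (fastforce simp: sig_parts_Some split: option.splits intro: Snd_E)
next
  case (Succ n)
  then show ?case by (auto split: if_splits intro!: Succ_I intro: infers_sound)
qed (auto simp: level_Some split: option.splits
  intro: Univ_F Empty_F Unit_F Unit_I Two_F Two0_I Two1_I Nat_F Zero_I Id_I Trunc_F Trunc_I)

fun ctx_ok :: "tm list \<Rightarrow> bool" where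
  "ctx_ok [] = True"
| "ctx_ok (A # \<Gamma>) = (ctx_ok \<Gamma> \<and> level (infer A \<Gamma>) \<noteq> None)"

lemma ctx_ok_sound: "ctx_ok \<Gamma> \<Longrightarrow> \<turnstile> \<Gamma>"
  by (induction \<Gamma>) (auto simp: level_Some intro: ctx_Nil ctx_Cons infer_sound)

lemma has_infer: "ctx_ok \<Gamma> \<Longrightarrow> infers (infer t \<Gamma>) T \<Longrightarrow> \<Gamma> \<turnstile> t \<Colon> T"
  by (blast intro: infers_sound infer_sound ctx_ok_sound)

section \<open>Closed provability with lemmas as hypotheses\<close>

definition provable :: "ptm \<Rightarrow> bool" where
  "provable T \<longleftrightarrow> (\<exists>t. [] \<turnstile> t \<Colon> T 0)"

lemma provable_mp: "provable (A \<rightarrow>\<^sub>h B) \<Longrightarrow> provable A \<Longrightarrow> provable B"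
  unfolding provable_def arr_def Arr_def by (metis Pi_E sub_Var sub_wk)

text \<open>A cut rule: \<open>t\<close> is checked against the nested arrow whose domains are the
  statements in \<open>Ls\<close>, and these are then discharged by modus ponens. The proofs of the
  lemmas thus never enter the term under inference.\<close>

lemma provable_from:
  assumes "\<forall>L \<in> set Ls. provable L" and "infers (infer (t 0) []) (foldr (\<rightarrow>\<^sub>h) Ls T 0)"
  shows "provable T"
proof -
  have "provable (foldr (\<rightarrow>\<^sub>h) Ls T)"
    unfolding provable_def using assms(2) by (intro exI has_infer) simp_all
  with assms(1) show ?thesis
    by (induction Ls) (auto intro: provable_mp)
qed

lemmas run = hoas infers_def max_def

section \<open>Inhabited types over a context, path induction and conversion\<close>

definition inh :: "tm list \<Rightarrow> tm \<Rightarrow> bool" where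
  "inh \<Gamma> T \<longleftrightarrow> (\<exists>t. \<Gamma> \<turnstile> t \<Colon> T)"

lemma provable_inh: "provable T \<longleftrightarrow> inh [] (T 0)"
  by (simp add: provable_def inh_def)

lemma inhI: "\<Gamma> \<turnstile> t \<Colon> T \<Longrightarrow> inh \<Gamma> T"
  by (auto simp: inh_def)

lemma inh_infer: "ctx_ok \<Gamma> \<Longrightarrow> infers (infer t \<Gamma>) T \<Longrightarrow> inh \<Gamma> T"
  by (rule inhI) (rule has_infer)

primrec telescope :: "tm list \<Rightarrow> tm \<Rightarrow> tm" where
  "telescope [] T = T"
| "telescope (A # \<Gamma>) T = telescope \<Gamma> (PiT A T)"

lemma inh_Pi: "inh (A # \<Gamma>) B \<Longrightarrow> ctx_ok (A # \<Gamma>) \<Longrightarrow> inh \<Gamma> (PiT A B)"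
  by (auto simp: inh_def level_Some intro: Pi_I infer_sound ctx_ok_sound)

lemma inh_telescope: "inh \<Gamma> T \<Longrightarrow> ctx_ok \<Gamma> \<Longrightarrow> inh [] (telescope \<Gamma> T)"
proof (induction \<Gamma> arbitrary: T)
  case (Cons A \<Gamma>)
  then show ?case using inh_Pi[OF Cons.prems] by simp
qed simp

lemma provable_telescope:
  "inh \<Gamma> S \<Longrightarrow> ctx_ok \<Gamma> \<Longrightarrow> T 0 = telescope \<Gamma> S \<Longrightarrow> provable T"
  by (simp add: provable_inh inh_telescope)

lemma inh_conv: "inh \<Gamma> A \<Longrightarrow> \<Gamma> \<turnstile> A \<doteq> B \<Colon> Univ i \<Longrightarrow> inh \<Gamma> B"
  by (auto simp: inh_def intro: Conv)

text \<open>Based path induction: \<open>D\<close> is the motive at reflexivity and \<open>T\<close>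
  the motive at \<open>p\<close>. The equations let simplification rather than unification compute
  the substitutions. The motive comes with a derivation because it may contain pairs, which
  \<open>infer\<close> rejects.\<close>

lemma inh_J:
  assumes "inh \<Gamma> D" and "D = inst2 C a (Refl a)" and "T = inst2 C b p" and "ctx_ok \<Gamma>"
    and "infers (infer p \<Gamma>) (IdT A a b)" "infers (infer a \<Gamma>) A" "infers (infer b \<Gamma>) A"
    and "IdT (wk A) (wk a) (Var 0) # A # \<Gamma> \<turnstile> C \<Colon> Univ l"
  shows "inh \<Gamma> T"
  using assms unfolding inh_def by (blast intro: Id_E has_infer)

lemma inh_J_infer:
  assumes "inh \<Gamma> D" and "D = inst2 C a (Refl a)" and "T = inst2 C b p"
    and "ctx_ok (IdT (wk A) (wk a) (Var 0) # A # \<Gamma>)"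
    and "infers (infer p \<Gamma>) (IdT A a b)" "infers (infer a \<Gamma>) A" "infers (infer b \<Gamma>) A"
    and "infers (infer C (IdT (wk A) (wk a) (Var 0) # A # \<Gamma>)) (Univ l)"
  shows "inh \<Gamma> T"
  using assms(4) by (intro inh_J[OF assms(1-3) _ assms(5-7) has_infer[OF assms(4,8)]]) simp

text \<open>A judgemental equality becomes a path: reflexivity at \<open>x\<close> is converted
  along it.\<close>

lemma inh_refl:
  assumes "\<Gamma> \<turnstile> x \<doteq> y \<Colon> A" "ctx_ok \<Gamma>" "infers (infer A \<Gamma>) (Univ l)" "infers (infer x \<Gamma>) A"
  shows "inh \<Gamma> (IdT A x y)"
proof (rule inh_conv[OF inhI[OF Id_I]])
  show x: "\<Gamma> \<turnstile> x \<Colon> A" using assms(2,4) by (rule has_infer)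
  show "\<Gamma> \<turnstile> IdT A x x \<doteq> IdT A x y \<Colon> Univ l"
    using has_infer[OF assms(2,3)] x assms(1) by (intro Id_F_C Eq_refl)
qed

lemma beta_infer:
  assumes "ctx_ok (A # \<Gamma>)" "infers (infer b (A # \<Gamma>)) B" "infers (infer a \<Gamma>) A" "inst1 B a = T" "inst1 b a = c"
  shows "\<Gamma> \<turnstile> App (Lam A b) a \<doteq> c \<Colon> T"
  using assms by (auto simp: level_Some intro!: Pi_beta intro: infer_sound has_infer ctx_ok_sound)

text \<open>Chains computations through iterated application: first the head reduces, then the
  reduct applied to \<open>b\<close>.\<close>

lemma app_step:
  assumes "\<Gamma> \<turnstile> f \<doteq> f' \<Colon> PiT A C" "\<Gamma> \<turnstile> App f' b \<doteq> d \<Colon> T"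
    and "ctx_ok \<Gamma>" "infers (infer b \<Gamma>) A" "T = inst1 C b"
  shows "\<Gamma> \<turnstile> App f b \<doteq> d \<Colon> T"
  using Eq_trans[OF Pi_E_C[OF assms(1) Eq_refl[OF has_infer[OF assms(3,4)]]]] assms(2,5) by simp

section \<open>Paths in the booleans, the naturals and the universe\<close>

text \<open>This is the conjunction of \<open>X\<close> with the negation of \<open>b\<close>: it
  keeps \<open>X\<close> at 0 and gives 0 at 1.\<close>

definition sel :: "ptm \<Rightarrow> ptm \<Rightarrow> ptm" where
  "sel X b = twoind (\<lambda>_. two) X zero2 b"

definition Absurd :: "nat \<Rightarrow> ptm" where
  "Absurd i = pi (uni i) (\<lambda>R. one zero2 \<rightarrow>\<^sub>h R)"

text \<open>Large elimination: the family that is \<open>UnitT\<close> at 0 and the given type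
  \<open>R\<close> at 1 carries \<open>Star\<close> along the path to an element of
  \<open>R\<close>.\<close>

lemma provable_Absurd: "provable (Absurd i)"
proof -
  let ?\<Gamma> = "[IdT TwoT Two0 Two1, Univ i]"
  let ?C = "\<lambda>b. TwoInd (Univ i) UnitT (Var 1) b"
  \<comment> \<open>The motive for \<open>J\<close>: the moving end point is \<open>Var 1\<close>,
    and \<open>R\<close> has become \<open>Var 3\<close> under the two bound variables.\<close>
  let ?D = "TwoInd (Univ i) UnitT (Var 3) (Var 1)"
  have ctx: "ctx_ok ?\<Gamma>" by (simp add: infers_def)
  have "?\<Gamma> \<turnstile> ?C Two0 \<doteq> UnitT \<Colon> inst1 (Univ i) Two0"
    by (rule Two0_beta[where i = "Suc i"]; rule has_infer) (simp_all add: infers_def)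
  then have "inh ?\<Gamma> (?C Two0)"
    using inh_conv[OF inhI[OF Unit_I[OF ctx_ok_sound[OF ctx]]] Eq_sym] by simp
  then have "inh ?\<Gamma> (?C Two1)"
    by (rule inh_J_infer[where A = TwoT and a = Two0 and b = Two1 and p = "Var 0" and l = "Suc i" and C = ?D])
      (simp_all add: infers_def)
  moreover have "?\<Gamma> \<turnstile> ?C Two1 \<doteq> Var 1 \<Colon> inst1 (Univ i) Two1"
    by (rule Two1_beta[where i = "Suc i"]; rule has_infer) (simp_all add: infers_def)
  ultimately have "inh ?\<Gamma> (Var 1)"
    by (auto intro: inh_conv)
  then show ?thesis
    by (rule provable_telescope) (simp_all add: run Absurd_def)
qed

definition Transport :: ptm where
  "Transport = pi two (\<lambda>x. pi two (\<lambda>y. eq two x y \<rightarrow>\<^sub>h one x \<rightarrow>\<^sub>h one y))"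

lemma provable_Transport: "provable Transport"
proof -
  let ?\<Gamma> = "[IdT TwoT (Var 1) (Var 0), TwoT, TwoT]"
  let ?C = "PiT (IdT TwoT (Var 4) Two1) (IdT TwoT (Var 2) Two1)"
  have "inh ?\<Gamma> (PiT (IdT TwoT (Var 2) Two1) (IdT TwoT (Var 3) Two1))"
    by (rule inhI[where t = "Lam (IdT TwoT (Var 2) Two1) (Var 0)"], rule has_infer) (simp_all add: infers_def)
  then have "inh ?\<Gamma> (PiT (IdT TwoT (Var 2) Two1) (IdT TwoT (Var 2) Two1))"
    by (rule inh_J_infer[where A = TwoT and a = "Var 2" and b = "Var 1" and p = "Var 0" and l = 0 and C = ?C])
      (simp_all add: infers_def)
  then show ?thesis
    by (rule provable_telescope) (simp_all add: run Transport_def)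
qed

definition Transport_back :: ptm where
  "Transport_back = pi two (\<lambda>x. pi two (\<lambda>y. eq two x y \<rightarrow>\<^sub>h one y \<rightarrow>\<^sub>h one x))"

text \<open>A separate path induction, with the moving end point in the domain, takes the place of
  inverting the path.\<close>

lemma provable_Transport_back: "provable Transport_back"
proof -
  let ?\<Gamma> = "[IdT TwoT (Var 1) (Var 0), TwoT, TwoT]"
  let ?C = "PiT (IdT TwoT (Var 1) Two1) (IdT TwoT (Var 5) Two1)"
  have "inh ?\<Gamma> (PiT (IdT TwoT (Var 2) Two1) (IdT TwoT (Var 3) Two1))"
    by (rule inhI[where t = "Lam (IdT TwoT (Var 2) Two1) (Var 0)"], rule has_infer) (simp_all add: infers_def)
  then have "inh ?\<Gamma> (PiT (IdT TwoT (Var 1) Two1) (IdT TwoT (Var 3) Two1))"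
    by (rule inh_J_infer[where A = TwoT and a = "Var 2" and b = "Var 1" and p = "Var 0" and l = 0 and C = ?C])
      (simp_all add: infers_def)
  then show ?thesis
    by (rule provable_telescope) (simp_all add: run Transport_back_def)
qed

text \<open>The computation rules of \<open>sel\<close> are internalised as paths, since
  \<open>infer\<close> does not compute.\<close>

definition Sel_zero :: ptm where "Sel_zero = pi two (\<lambda>X. eq two (sel X zero2) X)"

lemma provable_Sel_zero: "provable Sel_zero"
proof -
  have "[TwoT] \<turnstile> TwoInd TwoT (Var 0) Two0 Two0 \<doteq> Var 0 \<Colon> inst1 TwoT Two0"
    by (rule Two0_beta[where i = 0]; rule has_infer) (simp_all add: infers_def)
  then have "inh [TwoT] (IdT TwoT (TwoInd TwoT (Var 0) Two0 Two0) (Var 0))"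
    by (intro inh_refl[where l = 0]) (simp_all add: infers_def)
  then show ?thesis
    by (rule provable_telescope) (simp_all add: run Sel_zero_def sel_def)
qed

definition Sel_one :: ptm where "Sel_one = pi two (\<lambda>X. eq two (sel X one2) zero2)"

lemma provable_Sel_one: "provable Sel_one"
proof -
  have "[TwoT] \<turnstile> TwoInd TwoT (Var 0) Two0 Two1 \<doteq> Two0 \<Colon> inst1 TwoT Two1"
    by (rule Two1_beta[where i = 0]; rule has_infer) (simp_all add: infers_def)
  then have "inh [TwoT] (IdT TwoT (TwoInd TwoT (Var 0) Two0 Two1) Two0)"
    by (intro inh_refl[where l = 0]) (simp_all add: infers_def)
  then show ?thesis
    by (rule provable_telescope) (simp_all add: run Sel_one_def sel_def)
qed

definition Suc_cong :: ptm where
  "Suc_cong = pi nats (\<lambda>n. pi nats (\<lambda>m. eq nats n m \<rightarrow>\<^sub>h eq nats (nsuc n) (nsuc m)))"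

lemma provable_Suc_cong: "provable Suc_cong"
proof -
  let ?\<Gamma> = "[IdT NatT (Var 1) (Var 0), NatT, NatT]"
  have "inh ?\<Gamma> (IdT NatT (Succ (Var 2)) (Succ (Var 2)))"
    by (rule inh_infer[where t = "Refl (Succ (Var 2))"]) (simp_all add: infers_def)
  then have "inh ?\<Gamma> (IdT NatT (Succ (Var 2)) (Succ (Var 1)))"
    by (rule inh_J_infer[where A = NatT and a = "Var 2" and b = "Var 1" and p = "Var 0" and l = 0
        and C = "IdT NatT (Succ (Var 4)) (Succ (Var 1))"]) (simp_all add: infers_def)
  then show ?thesis
    by (rule provable_telescope) (simp_all add: run Suc_cong_def)
qed

definition Euclidean :: ptm where
  "Euclidean = pi (uni 0) (\<lambda>A. pi A (\<lambda>x. pi A (\<lambda>y. pi A (\<lambda>z.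
    eq A x y \<rightarrow>\<^sub>h eq A x z \<rightarrow>\<^sub>h eq A y z))))"

text \<open>Path induction on \<open>x = y\<close>; at reflexivity the claim is the second
  hypothesis. One lemma thus does the work of symmetry and transitivity for two paths with a common
  start.\<close>

lemma provable_Euclidean: "provable Euclidean"
proof -
  let ?\<Gamma> = "[IdT (Var 4) (Var 3) (Var 1), IdT (Var 3) (Var 2) (Var 1), Var 2, Var 1, Var 0, Univ 0]"
  have "inh ?\<Gamma> (IdT (Var 5) (Var 4) (Var 2))"
    by (rule inh_infer[where t = "Var 0"]) (simp_all add: infers_def)
  then have "inh ?\<Gamma> (IdT (Var 5) (Var 3) (Var 2))"
    by (rule inh_J_infer[where A = "Var 5" and a = "Var 4" and b = "Var 3" and p = "Var 1" and l = 0
        and C = "IdT (Var 7) (Var 1) (Var 4)"]) (simp_all add: infers_def)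
  then show ?thesis
    by (rule provable_telescope) (simp_all add: run Euclidean_def)
qed

definition Cast :: "nat \<Rightarrow> ptm" where
  "Cast i = pi (uni i) (\<lambda>P. pi (uni i) (\<lambda>Q. eq (uni i) P Q \<rightarrow>\<^sub>h P \<rightarrow>\<^sub>h Q))"

lemma provable_Cast: "provable (Cast i)"
proof -
  let ?\<Gamma> = "[IdT (Univ i) (Var 1) (Var 0), Univ i, Univ i]"
  have "inh ?\<Gamma> (PiT (Var 2) (Var 3))"
    by (rule inh_infer[where t = "Lam (Var 2) (Var 0)"]) (simp_all add: infers_def)
  then have "inh ?\<Gamma> (PiT (Var 2) (Var 2))"
    by (rule inh_J_infer[where A = "Univ i" and a = "Var 2" and b = "Var 1" and p = "Var 0" and l = i
        and C = "PiT (Var 4) (Var 2)"]) (simp_all add: infers_def)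
  then show ?thesis
    by (rule provable_telescope) (simp_all add: run Cast_def)
qed

definition Cast_back :: "nat \<Rightarrow> ptm" where
  "Cast_back i = pi (uni i) (\<lambda>P. pi (uni i) (\<lambda>Q. eq (uni i) P Q \<rightarrow>\<^sub>h Q \<rightarrow>\<^sub>h P))"

lemma provable_Cast_back: "provable (Cast_back i)"
proof -
  let ?\<Gamma> = "[IdT (Univ i) (Var 1) (Var 0), Univ i, Univ i]"
  have "inh ?\<Gamma> (PiT (Var 2) (Var 3))"
    by (rule inh_infer[where t = "Lam (Var 2) (Var 0)"]) (simp_all add: infers_def)
  then have "inh ?\<Gamma> (PiT (Var 1) (Var 3))"
    by (rule inh_J_infer[where A = "Univ i" and a = "Var 2" and b = "Var 1" and p = "Var 0" and l = i
        and C = "PiT (Var 1) (Var 5)"]) (simp_all add: infers_def)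
  then show ?thesis
    by (rule provable_telescope) (simp_all add: run Cast_back_def)
qed

section \<open>Truncation\<close>

definition Trunc_map :: "nat \<Rightarrow> ptm" where
  "Trunc_map i = pi (uni i) (\<lambda>A. pi (uni i) (\<lambda>B. (A \<rightarrow>\<^sub>h trunc B) \<rightarrow>\<^sub>h trunc A \<rightarrow>\<^sub>h trunc B))"

text \<open>The given function already has a truncated target, so this is the monadic extension.
  \<open>Trunc_E\<close> applies because \<open>TrEq\<close> makes \<open>Trunc B\<close> a
  proposition.\<close>

lemma provable_Trunc_map: "provable (Trunc_map i)"
proof -
  let ?\<Gamma> = "[Trunc (Var 2), PiT (Var 1) (Trunc (Var 1)), Univ i, Univ i]"
  have "Trunc (Var 3) # Trunc (Var 2) # ?\<Gamma> \<turnstile> TrEq (Var 1) (Var 0) \<Colon> IdT (Trunc (Var 4)) (Var 1) (Var 0)"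
    by (rule Trunc_prop; rule has_infer) (simp_all add: infers_def)
  then have "Trunc (Var 2) # ?\<Gamma> \<turnstile> Lam (Trunc (Var 3)) (TrEq (Var 1) (Var 0))
      \<Colon> PiT (Trunc (Var 3)) (IdT (Trunc (Var 4)) (Var 1) (Var 0))"
    by (rule Pi_I[where i = i, rotated]) (rule has_infer, simp_all add: infers_def)
  then have "?\<Gamma> \<turnstile> Lam (Trunc (Var 2)) (Lam (Trunc (Var 3)) (TrEq (Var 1) (Var 0)))
      \<Colon> PiT (Trunc (Var 2)) (PiT (Trunc (Var 3)) (IdT (Trunc (Var 4)) (Var 1) (Var 0)))"
    by (rule Pi_I[where i = i, rotated]) (rule has_infer, simp_all add: infers_def)
  then have "?\<Gamma> \<turnstile> Lam (Trunc (Var 2)) (Lam (Trunc (Var 3)) (TrEq (Var 1) (Var 0))) \<Colon> isProp (Trunc (Var 2))"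
    by (simp add: isProp_def)
  then have "?\<Gamma> \<turnstile> TrRec (Lam (Trunc (Var 2)) (Lam (Trunc (Var 3)) (TrEq (Var 1) (Var 0)))) (Var 1) (Var 0) \<Colon> Trunc (Var 2)"
    by (rule Trunc_E[where i = i and A = "Var 3", OF has_infer _ has_infer has_infer, rotated 2]) (simp_all add: run)
  from inhI[OF this] show ?thesis
    by (rule provable_telescope) (simp_all add: run Trunc_map_def)
qed

section \<open>Uniqueness of paths to 1 in the booleans\<close>

text \<open>As \<open>J\<close> fixes the left end point, the loop \<open>q\<close> is generalised to \<open>q : 1 = b\<close>, and \<open>loop_map b q = q\<close>
  is proved by path induction; at \<open>b = 1\<close> the left side computes to reflexivity.\<close>

abbreviation loop_map :: "tm \<Rightarrow> tm" where
  "loop_map b \<equiv> TwoInd (PiT (IdT TwoT Two1 (Var 0)) (IdT TwoT Two1 (Var 1)))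
    (Lam (IdT TwoT Two1 Two0) (Var 0)) (Lam (IdT TwoT Two1 Two1) (Refl Two1)) b"

definition Loop_trivial :: ptm where
  "Loop_trivial = pi (one one2) (\<lambda>q. eq (one one2) (rfl one2) q)"

lemma provable_Loop_trivial: "provable Loop_trivial"
proof -
  let ?L = "IdT TwoT Two1 Two1"
  let ?\<Gamma> = "[?L]"
  \<comment> \<open>Stated for every \<open>q\<close> because it is used at reflexivity in the base
    case and at the given loop after the induction.\<close>
  have eq: "?\<Gamma> \<turnstile> App (loop_map Two1) q \<doteq> Refl Two1 \<Colon> ?L" if q: "infers (infer q ?\<Gamma>) ?L" for q
  proof (rule app_step)
    show "?\<Gamma> \<turnstile> loop_map Two1 \<doteq> Lam ?L (Refl Two1) \<Colon> PiT ?L ?L"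
      using Two1_beta[of ?\<Gamma> "PiT (IdT TwoT Two1 (Var 0)) (IdT TwoT Two1 (Var 1))" 0
        "Lam (IdT TwoT Two1 Two0) (Var 0)" "Lam (IdT TwoT Two1 Two1) (Refl Two1)"]
      by (simp add: has_infer infers_def)
    show "?\<Gamma> \<turnstile> App (Lam ?L (Refl Two1)) q \<doteq> Refl Two1 \<Colon> ?L"
      using q by (intro beta_infer[where B = ?L]) (simp_all add: infers_def)
  qed (use q in \<open>simp_all add: infers_def\<close>)
  have L: "?\<Gamma> \<turnstile> ?L \<doteq> ?L \<Colon> Univ 0" by (intro Eq_refl has_infer) (simp_all add: infers_def)
  have refl: "infers (infer (Refl Two1) ?\<Gamma>) ?L" by (simp add: infers_def)
  have "inh ?\<Gamma> (IdT ?L (Refl Two1) (Refl Two1))"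
    by (rule inh_infer[where t = "Refl (Refl Two1)"]) (simp_all add: infers_def)
  then have "inh ?\<Gamma> (IdT ?L (App (loop_map Two1) (Refl Two1)) (Refl Two1))"
    by (rule inh_conv) (rule Id_F_C[OF L Eq_sym[OF eq[OF refl]] Eq_refl[OF has_infer[OF _ refl]]],
      simp add: infers_def)
  then have "inh ?\<Gamma> (IdT ?L (App (loop_map Two1) (Var 0)) (Var 0))"
    by (rule inh_J_infer[where A = TwoT and a = Two1 and b = Two1 and p = "Var 0" and l = 0
        and C = "IdT (IdT TwoT Two1 (Var 1)) (App (loop_map (Var 1)) (Var 0)) (Var 0)"])
      (simp_all add: infers_def)
  then have "inh ?\<Gamma> (IdT ?L (Refl Two1) (Var 0))"
    by (rule inh_conv) (rule Id_F_C[OF L eq Eq_refl[OF has_infer]]; simp add: infers_def)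
  then show ?thesis
    by (rule provable_telescope) (simp_all add: run Loop_trivial_def)
qed

section \<open>The types \<open>angle\<close>\<close>

lemma pair_has:
  assumes "ctx_ok \<Gamma>" "infers (infer a \<Gamma>) NatT" "infers (infer b \<Gamma>) (isOne f a)"
    and "infers (infer (wk f) (NatT # \<Gamma>)) (PiT NatT TwoT)"
  shows "\<Gamma> \<turnstile> MkPair a b \<Colon> angle f"
proof -
  \<comment> \<open>The family has to be typed under its binder; the separate hypothesis on
    \<open>wk f\<close> stands in for a weakening property of derivations.\<close>
  have "NatT # \<Gamma> \<turnstile> App (wk f) (Var 0) \<Colon> inst1 TwoT (Var 0)"
    using assms by (intro Pi_E[where A = NatT] has_infer) (simp_all add: infers_def)
  then have "NatT # \<Gamma> \<turnstile> isOne (wk f) (Var 0) \<Colon> Univ 0"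
    unfolding isOne_def using assms(1) by (intro Id_F) (simp_all add: has_infer infers_def)
  from Sig_I[OF this] show ?thesis
    unfolding angle_def using assms by (simp add: isOne_def has_infer)
qed

text \<open>As a hypothesis, this function lets the explicit terms form pairs although
  \<open>infer\<close> rejects \<open>MkPair\<close>.\<close>

definition Pairing :: ptm where
  "Pairing = pi seq (\<lambda>f. pi nats (\<lambda>n. one (f \<cdot> n) \<rightarrow>\<^sub>h ang f))"

lemma provable_Pairing: "provable Pairing"
proof -
  let ?\<Gamma> = "[IdT TwoT (App (Var 1) (Var 0)) Two1, NatT, PiT NatT TwoT]"
  have "?\<Gamma> \<turnstile> MkPair (Var 1) (Var 0) \<Colon> angle (Var 2)"
    by (rule pair_has) (simp_all add: infers_def isOne_def)
  from inhI[OF this] show ?thesis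
    by (rule provable_telescope) (simp_all add: run Pairing_def)
qed

definition Angle_Rosolini :: "nat \<Rightarrow> ptm" where
  "Angle_Rosolini i = pi seq (\<lambda>\<alpha>. isprop (ang \<alpha>) \<rightarrow>\<^sub>h (\<lambda>d. isRosolini i (ang \<alpha> d)))"

text \<open>The sequence and its proof of propositionality form the element of \<open>Ninf\<close>,
  and reflexivity is the path. What needs care is reducing the projection \<open>Fst ?u\<close>
  inside \<open>angle\<close>.\<close>

lemma provable_Angle_Rosolini: "provable (Angle_Rosolini i)"
proof -
  let ?\<Gamma> = "[isProp (angle (Var 0)), PiT NatT TwoT]"
  let ?u = "MkPair (Var 1) (Var 0)"
  let ?I = "\<lambda>a. IdT (Univ i) (angle (Var 1)) (angle a)"
  have u: "?\<Gamma> \<turnstile> ?u \<Colon> Ninf" unfolding Ninf_def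
    by (intro Sig_I[where i = 0] has_infer) (simp_all add: run)
  have wu: "NatT # ?\<Gamma> \<turnstile> Fst (MkPair (Var 2) (Var 1)) \<doteq> Var 2 \<Colon> PiT NatT TwoT"
    by (intro Fst_beta[where i = 0 and B = "isProp (angle (Var 0))"] has_infer) (simp_all add: run)
  have "NatT # ?\<Gamma> \<turnstile> App (Fst (MkPair (Var 2) (Var 1))) (Var 0) \<doteq> App (Var 2) (Var 0) \<Colon> inst1 TwoT (Var 0)"
    by (intro Pi_E_C[OF wu] Eq_refl has_infer) (simp_all add: run)
  then have "?\<Gamma> \<turnstile> angle (Fst ?u) \<doteq> angle (Var 1) \<Colon> Univ i"
    unfolding angle_def isOne_def
    by (simp, intro Sig_F_C Id_F_C Eq_refl has_infer) (simp_all add: run numeral_2_eq_2)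
  \<comment> \<open>A path type in \<open>Univ i\<close> lives one level higher, hence
    \<open>Suc i\<close>.\<close>
  then have I: "?\<Gamma> \<turnstile> ?I (Var 1) \<doteq> ?I (Fst ?u) \<Colon> Univ (Suc i)"
    by (intro Id_F_C Eq_refl Eq_sym[of _ "angle (Fst ?u)"] has_infer) (simp_all add: run)
  have "?\<Gamma> \<turnstile> Refl (angle (Var 1)) \<Colon> ?I (Var 1)"
    by (intro Id_I has_infer) (simp_all add: run)
  from Conv[OF this I] have "?\<Gamma> \<turnstile> Refl (angle (Var 1)) \<Colon> inst1 (IdT (Univ i) (angle (Var 2)) (angle (Fst (Var 0)))) ?u"
    by (simp add: angle_def isOne_def)
  then have "?\<Gamma> \<turnstile> MkPair ?u (Refl (angle (Var 1))) \<Colon> SigT Ninf (IdT (Univ i) (angle (Var 2)) (angle (Fst (Var 0))))"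
    by (rule Sig_I[where i = "Suc i", OF has_infer u, rotated 2]) (simp_all add: run)
  from inhI[OF Trunc_I[OF this]] show ?thesis
    by (rule provable_telescope) (simp_all add: run Angle_Rosolini_def)
qed

definition One_prop :: ptm where
  "One_prop = pi two (\<lambda>b. pi (one b) (\<lambda>p. pi (one b) (\<lambda>q. eq (one b) p q)))"

text \<open>By cases on \<open>b\<close>: at 0 a path to 1 is absurd, and at 1 both loops equal
  reflexivity, so \<open>Euclidean\<close> connects them.\<close>

lemma provable_One_prop: "provable One_prop"
  by (rule provable_from[where Ls = "[Absurd 0, Euclidean, Loop_trivial]" and t =
      "lam (Absurd 0) (\<lambda>absurd. lam Euclidean (\<lambda>euclid. lam Loop_trivial (\<lambda>loop.
        lam two (\<lambda>b. twoind (\<lambda>b. pi (one b) (\<lambda>p. pi (one b) (\<lambda>q. eq (one b) p q)))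
          (lam (one zero2) (\<lambda>p. lam (one zero2) (\<lambda>q. absurd \<cdot> eq (one zero2) p q \<cdot> p)))
          (lam (one one2) (\<lambda>p. lam (one one2) (\<lambda>q.
            euclid \<cdot> one one2 \<cdot> rfl one2 \<cdot> p \<cdot> q \<cdot> (loop \<cdot> p) \<cdot> (loop \<cdot> q))))
          b))))"])
    (simp add: provable_Absurd provable_Euclidean provable_Loop_trivial,
     simp add: run Absurd_def Euclidean_def Loop_trivial_def One_prop_def)

definition Unique :: "ptm \<Rightarrow> ptm" where
  "Unique f = pi nats (\<lambda>n. pi nats (\<lambda>m. one (f \<cdot> n) \<rightarrow>\<^sub>h one (f \<cdot> m) \<rightarrow>\<^sub>h eq nats n m))"

definition Angle_prop :: ptm where
  "Angle_prop = pi seq (\<lambda>f. Unique f \<rightarrow>\<^sub>h isprop (ang f))"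

text \<open>Uniqueness identifies the first components and \<open>One_prop\<close> the second ones.
  The two path inductions are nested, the one on the second component being carried out
  inside.\<close>

lemma provable_Angle_prop: "provable Angle_prop"
proof -
  let ?one = "\<lambda>f n. IdT TwoT (App f n) Two1"
  let ?U = "PiT NatT (PiT NatT (PiT (?one (Var 2) (Var 1)) (PiT (?one (Var 3) (Var 1)) (IdT NatT (Var 3) (Var 2)))))"
  \<comment> \<open>\<open>One_prop\<close> sits at the bottom of the context so that path terms can
    apply it as a variable; it is discharged by \<open>provable_mp\<close> at the end.\<close>
  let ?\<Gamma> = "[angle (Var 2), angle (Var 1), ?U, PiT NatT TwoT, One_prop 0]"
  let ?\<Delta> = "?one (Var 3) (Fst (Var 1)) # ?\<Gamma>"
  have ctx: "ctx_ok ?\<Delta>" by (simp add: run One_prop_def)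
  have "?\<Delta> \<turnstile> MkPair (Fst (Var 2)) (Snd (Var 2)) \<Colon> angle (Var 4)"
    by (rule pair_has) (simp_all add: run One_prop_def)
  from inhI[OF Id_I[OF this]]
  have "inh ?\<Delta> (IdT (angle (Var 4)) (MkPair (Fst (Var 2)) (Snd (Var 2))) (MkPair (Fst (Var 2)) (Var 0)))"
    by (rule inh_J[where A = "?one (Var 4) (Fst (Var 2))" and a = "Snd (Var 2)" and b = "Var 0" and l = 0
        and p = "App (App (App (Var 5) (App (Var 4) (Fst (Var 2)))) (Snd (Var 2))) (Var 0)"
        and C = "IdT (angle (Var 6)) (MkPair (Fst (Var 4)) (Snd (Var 4))) (MkPair (Fst (Var 4)) (Var 1))",
        OF _ _ _ _ _ _ _ Id_F[OF has_infer pair_has pair_has]])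
      (simp_all add: run One_prop_def)
  \<comment> \<open>The second component is quantified before the first one moves, because its type
    depends on the first. It is instantiated with \<open>Snd (Var 0)\<close> afterwards.\<close>
  from inh_Pi[OF this ctx]
  have "inh ?\<Gamma> (PiT (?one (Var 3) (Fst (Var 0)))
      (IdT (angle (Var 4)) (MkPair (Fst (Var 2)) (Snd (Var 2))) (MkPair (Fst (Var 1)) (Var 0))))"
    by (rule inh_J[where A = NatT and a = "Fst (Var 1)" and b = "Fst (Var 0)" and l = 0
        and p = "App (App (App (App (Var 2) (Fst (Var 1))) (Fst (Var 0))) (Snd (Var 1))) (Snd (Var 0))"
        and C = "PiT (?one (Var 5) (Var 1))
          (IdT (angle (Var 6)) (MkPair (Fst (Var 4)) (Snd (Var 4))) (MkPair (Var 2) (Var 0)))",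
        OF _ _ _ _ _ _ _ Pi_F[OF has_infer Id_F[OF has_infer pair_has pair_has]]])
      (simp_all add: run One_prop_def)
  then obtain t where t: "?\<Gamma> \<turnstile> t \<Colon> PiT (?one (Var 3) (Fst (Var 0)))
      (IdT (angle (Var 4)) (MkPair (Fst (Var 2)) (Snd (Var 2))) (MkPair (Fst (Var 1)) (Var 0)))"
    by (auto simp: inh_def)
  have "?\<Gamma> \<turnstile> Snd (Var 0) \<Colon> ?one (Var 3) (Fst (Var 0))"
    by (rule has_infer) (simp_all add: run One_prop_def)
  from inhI[OF Pi_E[OF t this]]
  have "inh ?\<Gamma> (IdT (angle (Var 3)) (MkPair (Fst (Var 1)) (Snd (Var 1))) (MkPair (Fst (Var 0)) (Snd (Var 0))))"
    by (simp add: angle_def isOne_def)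
  \<comment> \<open>The pairs of projections are contracted to the original elements by surjective
    pairing.\<close>
  moreover have "?\<Gamma> \<turnstile> IdT (angle (Var 3)) (Var 1) (Var 0)
      \<doteq> IdT (angle (Var 3)) (MkPair (Fst (Var 1)) (Snd (Var 1))) (MkPair (Fst (Var 0)) (Snd (Var 0))) \<Colon> Univ 0"
    unfolding angle_def by (intro Id_F_C Sig_eta Eq_refl has_infer) (simp_all add: run One_prop_def)
  ultimately have "inh ?\<Gamma> (IdT (angle (Var 3)) (Var 1) (Var 0))"
    by (blast intro: inh_conv Eq_sym)
  then have "provable (One_prop \<rightarrow>\<^sub>h Angle_prop)"
    by (rule provable_telescope) (simp_all add: run One_prop_def Angle_prop_def Unique_def)
  then show ?thesis
    using provable_One_prop by (rule provable_mp)
qed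

section \<open>First occurrences\<close>

text \<open>\<open>first \<alpha>\<close> is the sequence that is 1 exactly at the first place where \<open>\<alpha>\<close> is 1. The recursion
  varies \<open>\<alpha>\<close>, so that uniqueness and completeness are plain inductions generalised over \<open>\<alpha>\<close>.\<close>

definition shift :: ptm where
  "shift = lam seq (\<lambda>\<alpha>. lam nats (\<lambda>n. \<alpha> \<cdot> nsuc n))"
definition first :: ptm where
  "first = lam seq (\<lambda>\<alpha>. lam nats (\<lambda>n.
    natind (\<lambda>_. seq \<rightarrow>\<^sub>h two) (lam seq (\<lambda>\<alpha>. \<alpha> \<cdot> nzero))
      (\<lambda>n ih. lam seq (\<lambda>\<alpha>. sel (ih \<cdot> (shift \<cdot> \<alpha>)) (\<alpha> \<cdot> nzero))) n \<cdot> \<alpha>))"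

section \<open>Judgemental computation of \<open>shift\<close> and \<open>first\<close> in de Bruijn
  form\<close>

abbreviation "seq_tm \<equiv> PiT NatT TwoT"
abbreviation "shift_tm \<equiv> Lam seq_tm (Lam NatT (App (Var 1) (Succ (Var 0))))"
abbreviation "step_tm \<equiv> Lam seq_tm (TwoInd TwoT (App (Var 1) (App shift_tm (Var 0))) Two0 (App (Var 0) Zero))"
abbreviation "first_rec n \<equiv> NatInd (PiT seq_tm TwoT) (Lam seq_tm (App (Var 0) Zero)) step_tm n"
abbreviation "first_tm \<equiv> Lam seq_tm (Lam NatT (App (first_rec (Var 0)) (Var 1)))"

text \<open>The function is a parameter here, as in the equations for \<open>first\<close>, so that
  one formula serves both for the concrete term and for a variable standing for it.\<close>

definition Shift :: "ptm \<Rightarrow> ptm" where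
  "Shift sh = pi seq (\<lambda>\<alpha>. pi nats (\<lambda>n. eq two (sh \<cdot> \<alpha> \<cdot> n) (\<alpha> \<cdot> nsuc n)))"

lemma provable_Shift: "provable (Shift shift)"
proof -
  let ?\<Gamma> = "[NatT, seq_tm]"
  have "?\<Gamma> \<turnstile> App shift_tm (Var 1) \<doteq> Lam NatT (App (Var 2) (Succ (Var 0))) \<Colon> seq_tm"
    by (rule beta_infer[where B = seq_tm]) (simp_all add: run)
  moreover have "?\<Gamma> \<turnstile> App (Lam NatT (App (Var 2) (Succ (Var 0)))) (Var 0) \<doteq> App (Var 1) (Succ (Var 0)) \<Colon> TwoT"
    by (rule beta_infer[where B = TwoT]) (simp_all add: run)
  ultimately have "?\<Gamma> \<turnstile> App (App shift_tm (Var 1)) (Var 0) \<doteq> App (Var 1) (Succ (Var 0)) \<Colon> TwoT"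
    by (rule app_step) (simp_all add: run)
  then have "inh ?\<Gamma> (IdT TwoT (App (App shift_tm (Var 1)) (Var 0)) (App (Var 1) (Succ (Var 0))))"
    by (rule inh_refl[where l = 0]) (simp_all add: run)
  then show ?thesis
    by (rule provable_telescope) (simp_all add: run Shift_def shift_def)
qed

text \<open>Two beta steps expose the recursor; this is the common start of the zero and successor
  equations.\<close>

lemma first_tm_app:
  assumes "ctx_ok \<Gamma>" "infers (infer a \<Gamma>) seq_tm" "infers (infer n \<Gamma>) NatT"
    and "infers (infer (wk a) (NatT # \<Gamma>)) seq_tm"
  shows "\<Gamma> \<turnstile> App (App first_tm a) n \<doteq> App (first_rec n) a \<Colon> TwoT"
proof (rule app_step)
  show "\<Gamma> \<turnstile> App first_tm a \<doteq> Lam NatT (App (first_rec (Var 0)) (wk a)) \<Colon> seq_tm"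
    using assms by (intro beta_infer[where B = seq_tm]) (simp_all add: run)
  have "NatT # \<Gamma> \<turnstile> App (first_rec (Var 0)) (wk a) \<Colon> inst1 TwoT (wk a)"
    using assms by (intro Pi_E[where A = seq_tm] has_infer) (simp_all add: run)
  then have "\<Gamma> \<turnstile> App (Lam NatT (App (first_rec (Var 0)) (wk a))) n
      \<doteq> inst1 (App (first_rec (Var 0)) (wk a)) n \<Colon> inst1 TwoT n"
    using assms by (intro Pi_beta[where i = 0] has_infer[of _ n]) (simp_all add: has_infer infers_def)
  then show "\<Gamma> \<turnstile> App (Lam NatT (App (first_rec (Var 0)) (wk a))) n \<doteq> App (first_rec n) a \<Colon> TwoT"
    by simp
qed (use assms in simp_all)

definition First_zero :: "ptm \<Rightarrow> ptm" where
  "First_zero B = pi seq (\<lambda>\<alpha>. eq two (B \<cdot> \<alpha> \<cdot> nzero) (\<alpha> \<cdot> nzero))"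

lemma provable_First_zero: "provable (First_zero first)"
proof -
  let ?\<Gamma> = "[seq_tm]"
  have "?\<Gamma> \<turnstile> first_rec Zero \<doteq> Lam seq_tm (App (Var 0) Zero) \<Colon> inst1 (PiT seq_tm TwoT) Zero"
    by (rule Zero_beta[where i = 0]; rule has_infer) (simp_all add: run)
  then have "?\<Gamma> \<turnstile> first_rec Zero \<doteq> Lam seq_tm (App (Var 0) Zero) \<Colon> PiT seq_tm TwoT"
    by simp
  moreover have "?\<Gamma> \<turnstile> App (Lam seq_tm (App (Var 0) Zero)) (Var 0) \<doteq> App (Var 0) Zero \<Colon> TwoT"
    by (rule beta_infer[where B = TwoT]) (simp_all add: run)
  ultimately have "?\<Gamma> \<turnstile> App (first_rec Zero) (Var 0) \<doteq> App (Var 0) Zero \<Colon> TwoT"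
    by (rule app_step) (simp_all add: run)
  moreover have "?\<Gamma> \<turnstile> App (App first_tm (Var 0)) Zero \<doteq> App (first_rec Zero) (Var 0) \<Colon> TwoT"
    by (rule first_tm_app) (simp_all add: run)
  ultimately have "?\<Gamma> \<turnstile> App (App first_tm (Var 0)) Zero \<doteq> App (Var 0) Zero \<Colon> TwoT"
    by (rule Eq_trans[rotated])
  then have "inh ?\<Gamma> (IdT TwoT (App (App first_tm (Var 0)) Zero) (App (Var 0) Zero))"
    by (rule inh_refl[where l = 0]) (simp_all add: run)
  then show ?thesis
    by (rule provable_telescope) (simp_all add: run sel_def First_zero_def first_def shift_def)
qed

definition First_suc :: "ptm \<Rightarrow> ptm \<Rightarrow> ptm" where
  "First_suc sh B = pi seq (\<lambda>\<alpha>. pi nats (\<lambda>n.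
    eq two (B \<cdot> \<alpha> \<cdot> nsuc n) (sel (B \<cdot> (sh \<cdot> \<alpha>) \<cdot> n) (\<alpha> \<cdot> nzero))))"

lemma provable_First_suc: "provable (First_suc shift first)"
proof -
  let ?\<Gamma> = "[NatT, seq_tm]"
  let ?sel = "\<lambda>x. TwoInd TwoT x Two0 (App (Var 1) Zero)"
  let ?body = "Lam seq_tm (TwoInd TwoT (App (first_rec (Var 1)) (App shift_tm (Var 0))) Two0 (App (Var 0) Zero))"
  have "?\<Gamma> \<turnstile> first_rec (Succ (Var 0)) \<doteq> inst2 step_tm (Var 0) (first_rec (Var 0)) \<Colon> inst1 (PiT seq_tm TwoT) (Succ (Var 0))"
    by (rule Succ_beta[where i = 0]; rule has_infer) (simp_all add: run)
  then have "?\<Gamma> \<turnstile> first_rec (Succ (Var 0)) \<doteq> ?body \<Colon> PiT seq_tm TwoT"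
    by simp
  moreover have "?\<Gamma> \<turnstile> App ?body (Var 1) \<doteq> ?sel (App (first_rec (Var 0)) (App shift_tm (Var 1))) \<Colon> TwoT"
    by (rule beta_infer[where B = TwoT]) (simp_all add: run)
  ultimately have "?\<Gamma> \<turnstile> App (first_rec (Succ (Var 0))) (Var 1)
      \<doteq> ?sel (App (first_rec (Var 0)) (App shift_tm (Var 1))) \<Colon> TwoT"
    by (rule app_step) (simp_all add: run)
  moreover have "?\<Gamma> \<turnstile> App (App first_tm (Var 1)) (Succ (Var 0)) \<doteq> App (first_rec (Succ (Var 0))) (Var 1) \<Colon> TwoT"
    by (rule first_tm_app) (simp_all add: run)
  ultimately have l: "?\<Gamma> \<turnstile> App (App first_tm (Var 1)) (Succ (Var 0))
      \<doteq> ?sel (App (first_rec (Var 0)) (App shift_tm (Var 1))) \<Colon> TwoT"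
    by (rule Eq_trans[rotated])
  \<comment> \<open>The recursive call has appeared in unfolded form. It is folded back to
    \<open>first_tm\<close> at the shifted sequence and then replaced inside the case distinction by
    congruence.\<close>
  have "?\<Gamma> \<turnstile> App (App first_tm (App shift_tm (Var 1))) (Var 0)
      \<doteq> App (first_rec (Var 0)) (App shift_tm (Var 1)) \<Colon> inst1 TwoT Two0"
    using first_tm_app[of ?\<Gamma> "App shift_tm (Var 1)" "Var 0"] by (simp add: run)
  then have "?\<Gamma> \<turnstile> ?sel (App (App first_tm (App shift_tm (Var 1))) (Var 0))
      \<doteq> ?sel (App (first_rec (Var 0)) (App shift_tm (Var 1))) \<Colon> inst1 TwoT (App (Var 1) Zero)"
    by (rule Two_E_C[where i = 0, OF Eq_refl[OF has_infer] _ Eq_refl[OF has_infer] Eq_refl[OF has_infer], rotated 2])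
      (simp_all add: run)
  from Eq_trans[OF l Eq_sym, of "?sel (App (App first_tm (App shift_tm (Var 1))) (Var 0))"] this
  have "?\<Gamma> \<turnstile> App (App first_tm (Var 1)) (Succ (Var 0))
      \<doteq> ?sel (App (App first_tm (App shift_tm (Var 1))) (Var 0)) \<Colon> TwoT"
    by simp
  then have "inh ?\<Gamma> (IdT TwoT (App (App first_tm (Var 1)) (Succ (Var 0)))
      (?sel (App (App first_tm (App shift_tm (Var 1))) (Var 0))))"
    by (rule inh_refl[where l = 0]) (simp_all add: run)
  then show ?thesis
    by (rule provable_telescope) (simp_all add: run sel_def First_suc_def first_def shift_def)
qed

section \<open>Boolean reasoning for the successor steps\<close>

definition Sel_forward :: ptm where
  "Sel_forward = pi two (\<lambda>b. pi two (\<lambda>X. one (sel X b) \<rightarrow>\<^sub>h one X))"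

lemma provable_Sel_forward: "provable Sel_forward"
  by (rule provable_from[where Ls = "[Absurd 0, Transport, Sel_zero, Sel_one]" and t =
      "lam (Absurd 0) (\<lambda>absurd. lam Transport (\<lambda>tr. lam Sel_zero (\<lambda>sel0. lam Sel_one (\<lambda>sel1.
        lam two (\<lambda>b. lam two (\<lambda>X. twoind (\<lambda>b. one (sel X b) \<rightarrow>\<^sub>h one X)
          (lam (one (sel X zero2)) (\<lambda>p. tr \<cdot> sel X zero2 \<cdot> X \<cdot> (sel0 \<cdot> X) \<cdot> p))
          (lam (one (sel X one2)) (\<lambda>p. absurd \<cdot> one X \<cdot> (tr \<cdot> sel X one2 \<cdot> zero2 \<cdot> (sel1 \<cdot> X) \<cdot> p)))
          b))))))"])
    (simp add: provable_Absurd provable_Transport provable_Sel_zero provable_Sel_one,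
     simp add: run sel_def Absurd_def Transport_def Sel_zero_def Sel_one_def Sel_forward_def)

definition Sel_contra :: "nat \<Rightarrow> ptm" where
  "Sel_contra i = pi (uni i) (\<lambda>R. pi two (\<lambda>b. pi two (\<lambda>X. one b \<rightarrow>\<^sub>h one (sel X b) \<rightarrow>\<^sub>h R)))"

lemma provable_Sel_contra: "provable (Sel_contra i)"
  by (rule provable_from[where Ls = "[Absurd i, Transport, Sel_one]" and t =
      "lam (Absurd i) (\<lambda>absurd. lam Transport (\<lambda>tr. lam Sel_one (\<lambda>sel1.
        lam (uni i) (\<lambda>R. lam two (\<lambda>b. lam two (\<lambda>X. twoind (\<lambda>b. one b \<rightarrow>\<^sub>h one (sel X b) \<rightarrow>\<^sub>h R)
          (lam (one zero2) (\<lambda>p. lam (one (sel X zero2)) (\<lambda>q. absurd \<cdot> R \<cdot> p)))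
          (lam (one one2) (\<lambda>p. lam (one (sel X one2)) (\<lambda>q.
            absurd \<cdot> R \<cdot> (tr \<cdot> sel X one2 \<cdot> zero2 \<cdot> (sel1 \<cdot> X) \<cdot> q))))
          b))))))"])
    (simp add: provable_Absurd provable_Transport provable_Sel_one,
     simp add: run sel_def Absurd_def Transport_def Sel_one_def Sel_contra_def)

text \<open>The disjunction of \<open>b = 1\<close> and \<open>sel X b = 1\<close> is encoded by its
  elimination into \<open>R\<close>, as \<open>infer\<close> assigns no type to sums.\<close>

definition Sel_cases :: "nat \<Rightarrow> ptm" where
  "Sel_cases i = pi (uni i) (\<lambda>R. pi two (\<lambda>b. pi two (\<lambda>X.
    (one b \<rightarrow>\<^sub>h R) \<rightarrow>\<^sub>h (one (sel X b) \<rightarrow>\<^sub>h R) \<rightarrow>\<^sub>h one X \<rightarrow>\<^sub>h R)))"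

lemma provable_Sel_cases: "provable (Sel_cases i)"
  by (rule provable_from[where Ls = "[Transport_back, Sel_zero]" and t =
      "lam Transport_back (\<lambda>tr. lam Sel_zero (\<lambda>sel0.
        lam (uni i) (\<lambda>R. lam two (\<lambda>b. lam two (\<lambda>X.
          twoind (\<lambda>b. (one b \<rightarrow>\<^sub>h R) \<rightarrow>\<^sub>h (one (sel X b) \<rightarrow>\<^sub>h R) \<rightarrow>\<^sub>h one X \<rightarrow>\<^sub>h R)
          (lam (one zero2 \<rightarrow>\<^sub>h R) (\<lambda>f. lam (one (sel X zero2) \<rightarrow>\<^sub>h R) (\<lambda>g. lam (one X) (\<lambda>p.
            g \<cdot> (tr \<cdot> sel X zero2 \<cdot> X \<cdot> (sel0 \<cdot> X) \<cdot> p)))))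
          (lam (one one2 \<rightarrow>\<^sub>h R) (\<lambda>f. lam (one (sel X one2) \<rightarrow>\<^sub>h R) (\<lambda>g. lam (one X) (\<lambda>p. f \<cdot> rfl one2))))
          b)))))"])
    (simp add: provable_Transport_back provable_Sel_zero,
     simp add: run sel_def Transport_back_def Sel_zero_def Sel_cases_def)

text \<open>The three properties of \<open>first\<close> are proved for variables satisfying its recursion equations
  up to \<open>IdT\<close>, since inference does not unfold \<open>first\<close>.\<close>

definition with_first :: "(ptm \<Rightarrow> ptm \<Rightarrow> ptm) \<Rightarrow> ptm" where
  "with_first F = pi (seq \<rightarrow>\<^sub>h seq) (\<lambda>sh. pi (seq \<rightarrow>\<^sub>h seq) (\<lambda>B.
    First_zero B \<rightarrow>\<^sub>h First_suc sh B \<rightarrow>\<^sub>h Shift sh \<rightarrow>\<^sub>h F sh B))"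
definition lam_first :: "(ptm \<Rightarrow> ptm \<Rightarrow> ptm \<Rightarrow> ptm \<Rightarrow> ptm \<Rightarrow> ptm) \<Rightarrow> ptm" where
  "lam_first F = lam (seq \<rightarrow>\<^sub>h seq) (\<lambda>sh. lam (seq \<rightarrow>\<^sub>h seq) (\<lambda>B.
    lam (First_zero B) (\<lambda>b0. lam (First_suc sh B) (\<lambda>bs. lam (Shift sh) (\<lambda>s. F sh B b0 bs s)))))"

lemmas first_run = run sel_def Transport_def Transport_back_def with_first_def lam_first_def First_zero_def
  First_suc_def Shift_def

definition First_sound :: ptm where
  "First_sound = with_first (\<lambda>sh B. pi nats (\<lambda>n. pi seq (\<lambda>\<alpha>. one (B \<cdot> \<alpha> \<cdot> n) \<rightarrow>\<^sub>h one (\<alpha> \<cdot> n))))"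

text \<open>In the successor step a 1 of \<open>B \<cdot> \<alpha>\<close> passes through
  \<open>sel\<close> to a 1 of \<open>B\<close> on the shifted sequence at \<open>n\<close>, where
  the inductive hypothesis applies.\<close>

lemma provable_First_sound: "provable First_sound"
  by (rule provable_from[where Ls = "[Transport, Sel_forward]" and t =
      "lam Transport (\<lambda>tr. lam Sel_forward (\<lambda>fwd. lam_first (\<lambda>sh B b0 bs s. lam nats (\<lambda>n.
        natind (\<lambda>n. pi seq (\<lambda>\<alpha>. one (B \<cdot> \<alpha> \<cdot> n) \<rightarrow>\<^sub>h one (\<alpha> \<cdot> n)))
          (lam seq (\<lambda>\<alpha>. lam (one (B \<cdot> \<alpha> \<cdot> nzero)) (\<lambda>p. tr \<cdot> (B \<cdot> \<alpha> \<cdot> nzero) \<cdot> (\<alpha> \<cdot> nzero) \<cdot> (b0 \<cdot> \<alpha>) \<cdot> p)))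
          (\<lambda>n ih. lam seq (\<lambda>\<alpha>. lam (one (B \<cdot> \<alpha> \<cdot> nsuc n)) (\<lambda>p.
            tr \<cdot> (sh \<cdot> \<alpha> \<cdot> n) \<cdot> (\<alpha> \<cdot> nsuc n) \<cdot> (s \<cdot> \<alpha> \<cdot> n) \<cdot> (ih \<cdot> (sh \<cdot> \<alpha>) \<cdot>
              (fwd \<cdot> (\<alpha> \<cdot> nzero) \<cdot> (B \<cdot> (sh \<cdot> \<alpha>) \<cdot> n) \<cdot>
                (tr \<cdot> (B \<cdot> \<alpha> \<cdot> nsuc n) \<cdot> sel (B \<cdot> (sh \<cdot> \<alpha>) \<cdot> n) (\<alpha> \<cdot> nzero) \<cdot> (bs \<cdot> \<alpha> \<cdot> n) \<cdot> p))))))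
          n))))"])
    (simp add: provable_Transport provable_Sel_forward,
     simp add: first_run Sel_forward_def First_sound_def)

definition First_complete :: ptm where
  "First_complete = with_first (\<lambda>sh B. pi nats (\<lambda>n. pi seq (\<lambda>\<alpha>. one (\<alpha> \<cdot> n) \<rightarrow>\<^sub>h ang (B \<cdot> \<alpha>))))"

text \<open>In the successor step the inductive hypothesis gives a place \<open>x\<close> for the
  shifted sequence. If \<open>\<alpha>\<close> is 1 at zero, the answer is zero; otherwise it is the
  successor of the first component of \<open>x\<close>. The variable \<open>x\<close> is a HOL
  abbreviation, substituted before inference.\<close>

lemma provable_First_complete: "provable First_complete"
  by (rule provable_from[where Ls = "[Transport_back, Sel_cases 0, Pairing]" and t =
      "lam Transport_back (\<lambda>tr. lam (Sel_cases 0) (\<lambda>cases. lam Pairing (\<lambda>pair. lam_first (\<lambda>sh B b0 bs s. lam nats (\<lambda>n.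
        natind (\<lambda>n. pi seq (\<lambda>\<alpha>. one (\<alpha> \<cdot> n) \<rightarrow>\<^sub>h ang (B \<cdot> \<alpha>)))
          (lam seq (\<lambda>\<alpha>. lam (one (\<alpha> \<cdot> nzero)) (\<lambda>p.
            pair \<cdot> (B \<cdot> \<alpha>) \<cdot> nzero \<cdot> (tr \<cdot> (B \<cdot> \<alpha> \<cdot> nzero) \<cdot> (\<alpha> \<cdot> nzero) \<cdot> (b0 \<cdot> \<alpha>) \<cdot> p))))
          (\<lambda>n ih. lam seq (\<lambda>\<alpha>. lam (one (\<alpha> \<cdot> nsuc n)) (\<lambda>p.
            (\<lambda>x. cases \<cdot> ang (B \<cdot> \<alpha>) \<cdot> (\<alpha> \<cdot> nzero) \<cdot> (B \<cdot> (sh \<cdot> \<alpha>) \<cdot> pfst x)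
              \<cdot> lam (one (\<alpha> \<cdot> nzero)) (\<lambda>r.
                  pair \<cdot> (B \<cdot> \<alpha>) \<cdot> nzero \<cdot> (tr \<cdot> (B \<cdot> \<alpha> \<cdot> nzero) \<cdot> (\<alpha> \<cdot> nzero) \<cdot> (b0 \<cdot> \<alpha>) \<cdot> r))
              \<cdot> lam (one (sel (B \<cdot> (sh \<cdot> \<alpha>) \<cdot> pfst x) (\<alpha> \<cdot> nzero))) (\<lambda>r.
                  pair \<cdot> (B \<cdot> \<alpha>) \<cdot> nsuc (pfst x) \<cdot>
                    (tr \<cdot> (B \<cdot> \<alpha> \<cdot> nsuc (pfst x)) \<cdot> sel (B \<cdot> (sh \<cdot> \<alpha>) \<cdot> pfst x) (\<alpha> \<cdot> nzero)
                      \<cdot> (bs \<cdot> \<alpha> \<cdot> pfst x) \<cdot> r))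
              \<cdot> psnd x)
            (ih \<cdot> (sh \<cdot> \<alpha>) \<cdot> (tr \<cdot> (sh \<cdot> \<alpha> \<cdot> n) \<cdot> (\<alpha> \<cdot> nsuc n) \<cdot> (s \<cdot> \<alpha> \<cdot> n) \<cdot> p)))))
          n)))))"])
    (simp add: provable_Transport_back provable_Sel_cases provable_Pairing,
     simp add: first_run Sel_cases_def Pairing_def First_complete_def)

definition First_unique :: ptm where
  "First_unique = with_first (\<lambda>sh B. pi nats (\<lambda>n. pi seq (\<lambda>\<alpha>. pi nats (\<lambda>m.
     one (B \<cdot> \<alpha> \<cdot> n) \<rightarrow>\<^sub>h one (B \<cdot> \<alpha> \<cdot> m) \<rightarrow>\<^sub>h eq nats n m))))"

text \<open>The recursion on \<open>m\<close> inside that on \<open>n\<close> acts as a case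
  distinction. When exactly one index is zero, \<open>\<alpha>\<close> is 1 at zero and
  \<open>sel\<close> gives 0 at the other index, a contradiction; two successors reduce to the
  shifted sequence.\<close>

lemma provable_First_unique: "provable First_unique"
  by (rule provable_from[where Ls = "[Transport, Sel_forward, Sel_contra 0, Suc_cong]" and t =
      "lam Transport (\<lambda>tr. lam Sel_forward (\<lambda>fwd. lam (Sel_contra 0) (\<lambda>contra. lam Suc_cong (\<lambda>cong.
       lam_first (\<lambda>sh B b0 bs s.
        (\<lambda>at_zero at_suc. lam nats (\<lambda>n.
        natind (\<lambda>n. pi seq (\<lambda>\<alpha>. pi nats (\<lambda>m. one (B \<cdot> \<alpha> \<cdot> n) \<rightarrow>\<^sub>h one (B \<cdot> \<alpha> \<cdot> m) \<rightarrow>\<^sub>h eq nats n m)))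
          (lam seq (\<lambda>\<alpha>. lam nats (\<lambda>m.
            natind (\<lambda>m. one (B \<cdot> \<alpha> \<cdot> nzero) \<rightarrow>\<^sub>h one (B \<cdot> \<alpha> \<cdot> m) \<rightarrow>\<^sub>h eq nats nzero m)
              (lam (one (B \<cdot> \<alpha> \<cdot> nzero)) (\<lambda>p. lam (one (B \<cdot> \<alpha> \<cdot> nzero)) (\<lambda>q. rfl nzero)))
              (\<lambda>m _. lam (one (B \<cdot> \<alpha> \<cdot> nzero)) (\<lambda>p. lam (one (B \<cdot> \<alpha> \<cdot> nsuc m)) (\<lambda>q.
                contra \<cdot> eq nats nzero (nsuc m) \<cdot> (\<alpha> \<cdot> nzero) \<cdot> (B \<cdot> (sh \<cdot> \<alpha>) \<cdot> m) \<cdot> at_zero \<alpha> p \<cdot> at_suc \<alpha> m q)))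
              m)))
          (\<lambda>n ih. lam seq (\<lambda>\<alpha>. lam nats (\<lambda>m.
            natind (\<lambda>m. one (B \<cdot> \<alpha> \<cdot> nsuc n) \<rightarrow>\<^sub>h one (B \<cdot> \<alpha> \<cdot> m) \<rightarrow>\<^sub>h eq nats (nsuc n) m)
              (lam (one (B \<cdot> \<alpha> \<cdot> nsuc n)) (\<lambda>p. lam (one (B \<cdot> \<alpha> \<cdot> nzero)) (\<lambda>q.
                contra \<cdot> eq nats (nsuc n) nzero \<cdot> (\<alpha> \<cdot> nzero) \<cdot> (B \<cdot> (sh \<cdot> \<alpha>) \<cdot> n) \<cdot> at_zero \<alpha> q \<cdot> at_suc \<alpha> n p)))
              (\<lambda>m _. lam (one (B \<cdot> \<alpha> \<cdot> nsuc n)) (\<lambda>p. lam (one (B \<cdot> \<alpha> \<cdot> nsuc m)) (\<lambda>q.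
                cong \<cdot> n \<cdot> m \<cdot> (ih \<cdot> (sh \<cdot> \<alpha>) \<cdot> m
                  \<cdot> (fwd \<cdot> (\<alpha> \<cdot> nzero) \<cdot> (B \<cdot> (sh \<cdot> \<alpha>) \<cdot> n) \<cdot> at_suc \<alpha> n p)
                  \<cdot> (fwd \<cdot> (\<alpha> \<cdot> nzero) \<cdot> (B \<cdot> (sh \<cdot> \<alpha>) \<cdot> m) \<cdot> at_suc \<alpha> m q)))))
              m)))
          n))
        (\<lambda>\<alpha> p. tr \<cdot> (B \<cdot> \<alpha> \<cdot> nzero) \<cdot> (\<alpha> \<cdot> nzero) \<cdot> (b0 \<cdot> \<alpha>) \<cdot> p)
        (\<lambda>\<alpha> n p. tr \<cdot> (B \<cdot> \<alpha> \<cdot> nsuc n) \<cdot> sel (B \<cdot> (sh \<cdot> \<alpha>) \<cdot> n) (\<alpha> \<cdot> nzero) \<cdot> (bs \<cdot> \<alpha> \<cdot> n) \<cdot> p))))))"])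
    (simp add: provable_Transport provable_Sel_forward provable_Sel_contra provable_Suc_cong,
     simp add: first_run Sel_forward_def Sel_contra_def Suc_cong_def First_unique_def)

text \<open>The existence of \<open>\<beta>\<close> is stated by quantifying over an arbitrary conclusion \<open>R\<close>.\<close>

definition First_occurrence :: "nat \<Rightarrow> ptm" where
  "First_occurrence i = pi (uni i) (\<lambda>R. pi seq (\<lambda>\<alpha>. pi seq (\<lambda>\<beta>. isprop (ang \<beta>)
    \<rightarrow>\<^sub>h pi nats (\<lambda>n. one (\<beta> \<cdot> n) \<rightarrow>\<^sub>h one (\<alpha> \<cdot> n)) \<rightarrow>\<^sub>h pi nats (\<lambda>n. one (\<alpha> \<cdot> n) \<rightarrow>\<^sub>h ang \<beta>) \<rightarrow>\<^sub>h R) \<rightarrow>\<^sub>h R))"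

text \<open>The witness is \<open>first \<cdot> \<alpha>\<close>; the abstract properties are
  specialised to \<open>shift\<close> and \<open>first\<close> by passing their three
  equations.\<close>

lemma provable_First_occurrence: "provable (First_occurrence i)"
  by (rule provable_from[where Ls = "[First_unique, First_sound, First_complete, Angle_prop,
      First_zero first, First_suc shift first, Shift shift]" and t =
      "lam First_unique (\<lambda>unique. lam First_sound (\<lambda>sound. lam First_complete (\<lambda>complete. lam Angle_prop (\<lambda>prop.
        lam (First_zero first) (\<lambda>b0. lam (First_suc shift first) (\<lambda>bs. lam (Shift shift) (\<lambda>s.
        lam (uni i) (\<lambda>R. lam seq (\<lambda>\<alpha>. lam (pi seq (\<lambda>\<beta>. isprop (ang \<beta>)
          \<rightarrow>\<^sub>h pi nats (\<lambda>n. one (\<beta> \<cdot> n) \<rightarrow>\<^sub>h one (\<alpha> \<cdot> n)) \<rightarrow>\<^sub>h pi nats (\<lambda>n. one (\<alpha> \<cdot> n) \<rightarrow>\<^sub>h ang \<beta>) \<rightarrow>\<^sub>h R)) (\<lambda>k.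
        k \<cdot> (first \<cdot> \<alpha>)
          \<cdot> (prop \<cdot> (first \<cdot> \<alpha>) \<cdot> lam nats (\<lambda>n. lam nats (\<lambda>m. unique \<cdot> shift \<cdot> first \<cdot> b0 \<cdot> bs \<cdot> s \<cdot> n \<cdot> \<alpha> \<cdot> m)))
          \<cdot> lam nats (\<lambda>n. sound \<cdot> shift \<cdot> first \<cdot> b0 \<cdot> bs \<cdot> s \<cdot> n \<cdot> \<alpha>)
          \<cdot> lam nats (\<lambda>n. complete \<cdot> shift \<cdot> first \<cdot> b0 \<cdot> bs \<cdot> s \<cdot> n \<cdot> \<alpha>)))))))))))"])
    (simp add: provable_First_unique provable_First_sound provable_First_complete provable_Angle_prop
      provable_First_zero provable_First_suc provable_Shift,
     simp add: first_run Unique_def First_unique_def First_sound_def First_complete_def Angle_prop_def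
        shift_def first_def First_occurrence_def)

section \<open>The two choice principles\<close>

definition Bit_choice :: "nat \<Rightarrow> ptm" where
  "Bit_choice i = pi (uni i) (\<lambda>A. pi two (\<lambda>b. (one b \<rightarrow>\<^sub>h trunc A) \<rightarrow>\<^sub>h trunc (one b \<rightarrow>\<^sub>h A)))"

text \<open>By cases on \<open>b\<close>: at 0 the required function comes from absurdity; at 1 the
  hypothesis is evaluated at reflexivity and the resulting element is turned into a constant
  function under the truncation.\<close>

lemma provable_Bit_choice: "provable (Bit_choice i)"
  by (rule provable_from[where Ls = "[Absurd i, Trunc_map i]" and t =
      "lam (Absurd i) (\<lambda>absurd. lam (Trunc_map i) (\<lambda>map.
        lam (uni i) (\<lambda>A. lam two (\<lambda>b. twoind (\<lambda>b. (one b \<rightarrow>\<^sub>h trunc A) \<rightarrow>\<^sub>h trunc (one b \<rightarrow>\<^sub>h A))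
          (lam (one zero2 \<rightarrow>\<^sub>h trunc A) (\<lambda>f. trin (lam (one zero2) (\<lambda>p. absurd \<cdot> A \<cdot> p))))
          (lam (one one2 \<rightarrow>\<^sub>h trunc A) (\<lambda>f.
            map \<cdot> A \<cdot> (one one2 \<rightarrow>\<^sub>h A) \<cdot> lam A (\<lambda>a. trin (lam (one one2) (\<lambda>p. a))) \<cdot> (f \<cdot> rfl one2)))
          b))))"])
    (simp add: provable_Absurd provable_Trunc_map,
     simp add: run Absurd_def Trunc_map_def Bit_choice_def)

definition seq_choice :: "ptm \<Rightarrow> ptm" where
  "seq_choice A = (\<lambda>d. sequence_choice (A d))"
definition ros_choice :: "nat \<Rightarrow> ptm \<Rightarrow> ptm" where
  "ros_choice i A = (\<lambda>d. Rosolini_choice i (A d))"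
text \<open>The type under the truncation in \<open>isRosolini\<close>.\<close>

definition Rosolini_data :: "nat \<Rightarrow> ptm \<Rightarrow> ptm" where
  "Rosolini_data i P = sig (\<lambda>d. Ninf) (\<lambda>u. eq (uni i) P (ang (pfst u)))"

lemmas choice_run = run Trunc_map_def seq_choice_def ros_choice_def Rosolini_data_def
  sequence_choice_def Rosolini_choice_def

text \<open>The target is truncated, so the Rosolini data \<open>w\<close> may be opened;
  \<open>Trunc_map\<close> is taken at \<open>Suc i\<close> because \<open>w\<close> contains a path
  in \<open>Univ i\<close>. The casts along this path move elements between \<open>P\<close> and
  \<open>ang \<alpha>\<close> in both directions.\<close>

lemma provable_Rosolini_from_sequence: "provable (pi (uni i) (\<lambda>A. seq_choice A \<rightarrow>\<^sub>h ros_choice i A))"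
  by (rule provable_from[where Ls = "[Trunc_map (Suc i), Cast i, Cast_back i, Pairing, Bit_choice i]" and t =
      "lam (Trunc_map (Suc i)) (\<lambda>map. lam (Cast i) (\<lambda>cast. lam (Cast_back i) (\<lambda>cast'. lam Pairing (\<lambda>pair.
        lam (Bit_choice i) (\<lambda>bit.
        lam (uni i) (\<lambda>A. lam (seq_choice A) (\<lambda>s.
        lam (uni i) (\<lambda>P. lam (isprop P) (\<lambda>h. lam (trunc (Rosolini_data i P)) (\<lambda>r. lam (P \<rightarrow>\<^sub>h trunc A) (\<lambda>f.
        map \<cdot> Rosolini_data i P \<cdot> (P \<rightarrow>\<^sub>h A) \<cdot> lam (Rosolini_data i P) (\<lambda>w.
          (\<lambda>\<alpha>. map \<cdot> pi nats (\<lambda>n. one (\<alpha> \<cdot> n) \<rightarrow>\<^sub>h A) \<cdot> (P \<rightarrow>\<^sub>h A)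
            \<cdot> lam (pi nats (\<lambda>n. one (\<alpha> \<cdot> n) \<rightarrow>\<^sub>h A)) (\<lambda>g. trin (lam P (\<lambda>p.
                (\<lambda>x. g \<cdot> pfst x \<cdot> psnd x) (cast \<cdot> P \<cdot> ang \<alpha> \<cdot> psnd w \<cdot> p))))
            \<cdot> (s \<cdot> \<alpha> \<cdot> lam nats (\<lambda>n. bit \<cdot> A \<cdot> (\<alpha> \<cdot> n) \<cdot> lam (one (\<alpha> \<cdot> n)) (\<lambda>q.
                f \<cdot> (cast' \<cdot> P \<cdot> ang \<alpha> \<cdot> psnd w \<cdot> (pair \<cdot> \<alpha> \<cdot> n \<cdot> q))))))
          (pfst (pfst w))) \<cdot> r)))))))))))"])
    (simp add: provable_Trunc_map provable_Cast provable_Cast_back provable_Pairing provable_Bit_choice,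
     simp add: choice_run Cast_def Cast_back_def Pairing_def Bit_choice_def)

text \<open>In the term, \<open>first\<close> is the hypothesis \<open>First_occurrence\<close>,
  eliminated into \<open>trunc S\<close>. The map from \<open>ang \<beta>\<close> to
  \<open>trunc A\<close> takes a place of \<open>\<beta>\<close>, where \<open>\<alpha>\<close> is 1
  by \<open>sound\<close>, and evaluates the function given by \<open>h\<close> there under the
  truncation.\<close>

lemma provable_sequence_from_Rosolini: "provable (pi (uni i) (\<lambda>A. ros_choice i A \<rightarrow>\<^sub>h seq_choice A))"
  by (rule provable_from[where Ls = "[Trunc_map i, First_occurrence i, Angle_Rosolini i]" and t =
      "lam (Trunc_map i) (\<lambda>map. lam (First_occurrence i) (\<lambda>first. lam (Angle_Rosolini i) (\<lambda>ros.
        lam (uni i) (\<lambda>A. lam (ros_choice i A) (\<lambda>c.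
        lam seq (\<lambda>\<alpha>. lam (pi nats (\<lambda>n. trunc (one (\<alpha> \<cdot> n) \<rightarrow>\<^sub>h A))) (\<lambda>h.
        (\<lambda>S. first \<cdot> trunc S \<cdot> \<alpha> \<cdot> lam seq (\<lambda>\<beta>. lam (isprop (ang \<beta>)) (\<lambda>prop.
          lam (pi nats (\<lambda>n. one (\<beta> \<cdot> n) \<rightarrow>\<^sub>h one (\<alpha> \<cdot> n))) (\<lambda>sound.
          lam (pi nats (\<lambda>n. one (\<alpha> \<cdot> n) \<rightarrow>\<^sub>h ang \<beta>)) (\<lambda>complete.
          map \<cdot> (ang \<beta> \<rightarrow>\<^sub>h A) \<cdot> S
            \<cdot> lam (ang \<beta> \<rightarrow>\<^sub>h A) (\<lambda>g. trin (lam nats (\<lambda>n. lam (one (\<alpha> \<cdot> n)) (\<lambda>p. g \<cdot> (complete \<cdot> n \<cdot> p)))))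
            \<cdot> (c \<cdot> ang \<beta> \<cdot> prop \<cdot> (ros \<cdot> \<beta> \<cdot> prop) \<cdot> lam (ang \<beta>) (\<lambda>x.
                map \<cdot> (one (\<alpha> \<cdot> pfst x) \<rightarrow>\<^sub>h A) \<cdot> A
                  \<cdot> lam (one (\<alpha> \<cdot> pfst x) \<rightarrow>\<^sub>h A) (\<lambda>k. trin (k \<cdot> (sound \<cdot> pfst x \<cdot> psnd x)))
                  \<cdot> (h \<cdot> pfst x))))))))
        (pi nats (\<lambda>n. one (\<alpha> \<cdot> n) \<rightarrow>\<^sub>h A)))))))))"])
    (simp add: provable_Trunc_map provable_First_occurrence provable_Angle_Rosolini,
     simp add: choice_run First_occurrence_def Angle_Rosolini_def)

text \<open>The two implications enter as variables, leaving only a pair to be formed by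
  hand.\<close>

lemma provable_Iff:
  "provable (pi (uni i) (\<lambda>A. seq_choice A \<rightarrow>\<^sub>h ros_choice i A) \<rightarrow>\<^sub>h pi (uni i) (\<lambda>A. ros_choice i A \<rightarrow>\<^sub>h seq_choice A)
    \<rightarrow>\<^sub>h pi (uni i) (\<lambda>A d. seq_choice A d \<leftrightarrow>\<^sub>t ros_choice i A d))"
proof -
  let ?S = "sequence_choice (Var 0)" and ?R = "Rosolini_choice i (Var 0)"
  let ?\<Gamma> = "[Univ i, PiT (Univ i) (?R \<rightarrow>\<^sub>t ?S), PiT (Univ i) (?S \<rightarrow>\<^sub>t ?R)]"
  \<comment> \<open>The product lies in \<open>Univ (Suc i)\<close> since
    \<open>Rosolini_choice i\<close> quantifies over \<open>Univ i\<close>.\<close>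
  have "?\<Gamma> \<turnstile> MkPair (App (Var 2) (Var 0)) (App (Var 1) (Var 0)) \<Colon> ?S \<leftrightarrow>\<^sub>t ?R"
    unfolding Iff_def Times_def
    by (rule Sig_I[where i = "Suc i"]; rule has_infer) (simp_all add: choice_run)
  from inhI[OF this] show ?thesis
    by (rule provable_telescope) (simp_all add: choice_run)
qed

theorem theorem5p29:
  fixes i :: nat
  shows "\<exists>t. [] \<turnstile> t \<Colon> PiT (Univ i) (sequence_choice (Var 0) \<leftrightarrow>\<^sub>t Rosolini_choice i (Var 0))"
proof -
  have "provable (pi (uni i) (\<lambda>A d. seq_choice A d \<leftrightarrow>\<^sub>t ros_choice i A d))"
    using provable_Iff provable_Rosolini_from_sequence provable_sequence_from_Rosolini by (blast intro: provable_mp)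
  then show ?thesis
    by (simp add: provable_def pi_def uni_def bv_def seq_choice_def ros_choice_def)
qed

end
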